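(* Let $\alpha\in(0,1)$ and $n\in\mathbb N$. Let $\{\xi_\ell\}_{\ell\in\mathbb N}$ be a measurable enumeration of the points of a Poisson point process on $(0,\infty)$ with intensity $\alpha x^{-\alpha-1}dx$, and let $\boldsymbol Y_\ell=(Y_{\ell,1},\dots,Y_{\ell,n})$, $\ell\in\mathbb N$, be i.i.d. random vectors, independent of $\{\xi_\ell\}_{\ell\in\mathbb N}$, each having i.i.d. $1$-Fréchet components. Let $\Pi_n$ be the hitting partition of $[n]=\{1,\dots,n\}$ associated with the $\alpha$-logistic max-stable random vector $$(Z_1,\dots,Z_n)=\Big(\bigvee_{\ell=1}^\infty \xi_\ell Y_{\ell,1},\dots,\bigvee_{\ell=1}^\infty \xi_\ell Y_{\ell,n}\Big).$$ Then $\Pi_n$ is a $\mathrm{PD}(\alpha,0)$ partition of $[n]$; that is, for every partition $\pi$ of $[n]$ into $k$ blocks of sizes $n_1,\dots,n_k\ge1$ (with $n_1+\cdots+n_k=n$), $\mathbb P(\Pi_n=\pi)=p_{\alpha,0}(n_1,\dots,n_k)$.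
   Context: Notation: $\mathbb N=\{1,2,\dots\}$; $\bigvee$ denotes supremum. A random variable $Y$ is $1$-Fréchet with scale parameter $\sigma>0$ if $\mathbb P(Y\le x)=\exp(-\sigma/x)$ for $x\in(0,\infty)$. Hitting partition: for $k=1,\dots,n$ set $\ell^*(k):=\mathrm{argmax}_{\ell\in\mathbb N}\{\xi_\ell Y_{\ell,k}\}$, which is uniquely defined with probability one. The hitting partition $\Pi_n$ is the random partition of $[n]$ into the equivalence classes of the relation $i\sim j$ if and only if $\ell^*(i)=\ell^*(j)$, $i,j\in[n]$. $\mathrm{PD}(\alpha,\theta)$ partition of $[n]$ (Poisson–Dirichlet partition): the random partition of $[n]$ which equals any given partition of $[n]$ with block sizes $n_1,\dots,n_k$ with probability $$p_{\alpha,\theta}(n_1,\dots,n_k)=\frac{(\theta+\alpha)_{k-1\uparrow\alpha}\prod_{i=1}^k(1-\alpha)_{n_i-1\uparrow1}}{(\theta+1)_{n-1\uparrow1}},\qquad (x)_{m\uparrow\beta}:=\prod_{j=0}^{m-1}(x+j\beta),$$ with empty products equal to $1$. *)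

theory Defs
  imports "HOL-Probability.Probability"
begin

definition iid_vars :: "'w measure \<Rightarrow> 'b measure \<Rightarrow> ('i \<Rightarrow> 'w \<Rightarrow> 'b) \<Rightarrow> 'i set \<Rightarrow> bool" where
  "iid_vars M N X I \<longleftrightarrow>
     prob_space.indep_vars M (\<lambda>_. N) X I \<and>
     (\<forall>i\<in>I. \<forall>j\<in>I. distr M N (X i) = distr M N (X j))"

text \<open>
  \<^term>\<open>prob_space.indep_var\<close> would force both random elements to take values in the same type.
\<close>
definition indep_elements ::
  "'w measure \<Rightarrow> 'a measure \<Rightarrow> ('w \<Rightarrow> 'a) \<Rightarrow> 'b measure \<Rightarrow> ('w \<Rightarrow> 'b) \<Rightarrow> bool" where
  "indep_elements M N X N' X' \<longleftrightarrow>
     X \<in> measurable M N \<and> X' \<in> measurable M N' \<and>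
     prob_space.indep_set M
       {X -` A \<inter> space M | A. A \<in> sets N} {X' -` B \<inter> space M | B. B \<in> sets N'}"

definition frechet1 :: "'w measure \<Rightarrow> real \<Rightarrow> ('w \<Rightarrow> real) \<Rightarrow> bool" where
  "frechet1 M \<sigma> Y \<longleftrightarrow>
     Y \<in> borel_measurable M \<and>
     (\<forall>x>0. measure M {\<omega> \<in> space M. Y \<omega> \<le> x} = exp (- \<sigma> / x))"

definition point_count :: "(nat \<Rightarrow> 'w \<Rightarrow> 'a) \<Rightarrow> 'a set \<Rightarrow> 'w \<Rightarrow> ennreal" where
  "point_count X A \<omega> = emeasure (count_space UNIV) {l. X l \<omega> \<in> A}"

text \<open>
  \<open>X\<close> enumerates measurably, as an infinite sequence, the points of a Poisson point process
  on \<open>space \<mu>\<close> with intensity measure \<open>\<mu>\<close>. Points are counted with multiplicity. Sets of infinite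
  intensity contain infinitely many points almost surely (Poisson law with infinite mean).
\<close>
definition poisson_enumeration :: "'w measure \<Rightarrow> 'a measure \<Rightarrow> (nat \<Rightarrow> 'w \<Rightarrow> 'a) \<Rightarrow> bool" where
  "poisson_enumeration M \<mu> X \<longleftrightarrow>
     (\<forall>l. X l \<in> measurable M \<mu>) \<and>
     (\<forall>A\<in>sets \<mu>. emeasure \<mu> A < \<infinity> \<longrightarrow>
        (\<forall>k::nat. measure M {\<omega> \<in> space M. point_count X A \<omega> = of_nat k}
           = exp (- measure \<mu> A) * measure \<mu> A ^ k / fact k)) \<and>
     (\<forall>A\<in>sets \<mu>. emeasure \<mu> A = \<infinity> \<longrightarrow> (AE \<omega> in M. point_count X A \<omega> = \<infinity>)) \<and>
     (\<forall>(m::nat) A. (\<forall>i<m. A i \<in> sets \<mu>) \<longrightarrow> disjoint_family_on A {..<m} \<longrightarrow>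
        prob_space.indep_vars M (\<lambda>_. borel) (\<lambda>i. point_count X (A i)) {..<m})"

definition stable_intensity :: "real \<Rightarrow> real measure" where
  "stable_intensity \<alpha> =
     density (restrict_space lborel {0<..}) (\<lambda>x. ennreal (\<alpha> * x powr (- \<alpha> - 1)))"

text \<open>
  The argmax is almost surely unique. On the exceptional null set, where ties may occur or the
  supremum may not be attained, an arbitrary choice of maximiser need not be measurable;
  taking the least one makes the partition a genuine random variable without completing
  the probability space.
\<close>
definition hit_index ::
  "(nat \<Rightarrow> 'w \<Rightarrow> real) \<Rightarrow> (nat \<Rightarrow> nat \<Rightarrow> 'w \<Rightarrow> real) \<Rightarrow> 'w \<Rightarrow> nat \<Rightarrow> nat" where
  "hit_index \<xi> Y \<omega> k = (LEAST l. is_arg_max (\<lambda>l. \<xi> l \<omega> * Y l k \<omega>) (\<lambda>_. True) l)"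

definition hitting_partition ::
  "nat \<Rightarrow> (nat \<Rightarrow> 'w \<Rightarrow> real) \<Rightarrow> (nat \<Rightarrow> nat \<Rightarrow> 'w \<Rightarrow> real) \<Rightarrow> 'w \<Rightarrow> nat set set" where
  "hitting_partition n \<xi> Y \<omega> =
     {1..n} // {(i, j). i \<in> {1..n} \<and> j \<in> {1..n} \<and> hit_index \<xi> Y \<omega> i = hit_index \<xi> Y \<omega> j}"

text \<open>The generalised rising factorial \<open>(x)\<^bsub>m\<up>\<beta>\<^esub>\<close>; \<^term>\<open>pochhammer x m\<close> is the case \<open>\<beta> = 1\<close>.\<close>
definition rising :: "real \<Rightarrow> nat \<Rightarrow> real \<Rightarrow> real" where
  "rising x m \<beta> = (\<Prod>j<m. x + real j * \<beta>)"

definition pd_eppf :: "real \<Rightarrow> real \<Rightarrow> nat list \<Rightarrow> real" where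
  "pd_eppf \<alpha> \<theta> ns =
     rising (\<theta> + \<alpha>) (length ns - 1) \<alpha> * (\<Prod>m\<leftarrow>ns. rising (1 - \<alpha>) (m - 1) 1)
       / rising (\<theta> + 1) (sum_list ns - 1) 1"

text \<open>A partition is presented by a list \<open>bs\<close> of its distinct blocks, in any order.\<close>
definition pd_partition ::
  "'w measure \<Rightarrow> real \<Rightarrow> real \<Rightarrow> nat \<Rightarrow> ('w \<Rightarrow> nat set set) \<Rightarrow> bool" where
  "pd_partition M \<alpha> \<theta> n P \<longleftrightarrow>
     P \<in> measurable M (count_space {\<pi>. partition_on {1..n} \<pi>}) \<and>
     (\<forall>bs. distinct bs \<and> partition_on {1..n} (set bs) \<longrightarrow>
        measure M {\<omega> \<in> space M. P \<omega> = set bs} = pd_eppf \<alpha> \<theta> (map card bs))"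

end

theory Submission
  imports Defs
begin

text \<open>
  Inverting the Frechet variables turns each argmax into a race of independent exponential clocks,
  so conditionally on the points the hit indices are i.i.d. and equal to \<open>l\<close> with probability
  \<open>\<xi>\<^sub>l / S\<close>, where \<open>S = \<Sum>\<^sub>l \<xi>\<^sub>l\<close>. Hence the probability of a partition with block sizes
  \<open>n\<^sub>1, \<dots>, n\<^sub>k\<close> is the expectation of \<open>\<Sum> \<Prod>\<^sub>i \<xi>\<^bsub>l\<^sub>i\<^esub>\<^bsup>n\<^sub>i\<^esup> / S\<^sup>n\<close> over distinct \<open>l\<^sub>1, \<dots>, l\<^sub>k\<close>.
  Writing \<open>1 / S\<^sup>n\<close> as a Gamma integral of \<open>e\<^bsup>-tS\<^esup>\<close>, the expectation factorises for each \<open>t\<close> by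
  a multivariate Mecke formula, which is obtained by differentiating the Laplace functional of the
  Poisson process once for every point.
\<close>

section \<open>The exponential of a negated extended real\<close>

text \<open>Two obstacles shape the argument: values may be infinite, and limits must be justified
  without integrability. Until S is known to be finite, sums over points live in
  \<open>ennreal\<close>; almost sure finiteness comes from the Laplace transform as its argument
  tends to 0. Derivatives are replaced by difference quotients along steps 2^-j. These increase with
  j, so monotone convergence applies even where the sums over points diverge. With c = Gamma(1 -
  \<alpha>), the block of size m contributes \<alpha> Gamma(m - \<alpha>) t^(\<alpha> - m) and the
  Laplace functional contributes exp(-c t^\<alpha>). Against the kernel t^(n-1) all dependence on
  block sizes leaves the power of t, and t^(k \<alpha> - 1) remains. Its integral supplies (k - 1)!
  and the c^k in the denominator that cancels one factor c from each Gamma(m - \<alpha>).\<close>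

text \<open>The case distinction is essential: \<open>enn2real\<close> sends \<open>top\<close> to
  0, so the second branch alone would give 1 at infinity. The value 0 makes the function continuous
  and multiplicative on all of \<open>ennreal\<close>.\<close>

definition exp_neg :: "ennreal \<Rightarrow> ennreal" where
  "exp_neg a = (if a = \<infinity> then 0 else ennreal (exp (- enn2real a)))"

lemma exp_neg_ennreal: "0 \<le> r \<Longrightarrow> exp_neg (ennreal r) = ennreal (exp (- r))"
  by (simp add: exp_neg_def)

lemma exp_neg_top [simp]: "exp_neg \<infinity> = 0" "exp_neg top = 0"
  by (simp_all add: exp_neg_def)

lemma exp_neg_0 [simp]: "exp_neg 0 = 1"
  by (simp add: exp_neg_def)

lemma exp_neg_add: "exp_neg (a + b) = exp_neg a * exp_neg b"
  by (cases a; cases b) (simp_all add: exp_neg_ennreal ennreal_mult'[symmetric] exp_add[symmetric] ennreal_plus[symmetric] del: ennreal_plus)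

lemma exp_neg_antimono: "a \<le> b \<Longrightarrow> exp_neg b \<le> exp_neg a"
  by (cases a; cases b) (simp_all add: exp_neg_ennreal top_unique)

lemma exp_neg_le_1: "exp_neg a \<le> 1"
  using exp_neg_antimono[of 0 a] by simp

lemma exp_neg_less_top [simp]: "exp_neg a < top" "exp_neg a \<noteq> top"
  by (simp_all add: exp_neg_def)

lemma exp_neg_sum: "exp_neg (sum f I) = (\<Prod>i\<in>I. exp_neg (f i))"
  by (induction I rule: infinite_finite_induct) (simp_all add: exp_neg_add)

lemma exp_neg_measurable [measurable]: "exp_neg \<in> borel_measurable borel"
  unfolding exp_neg_def[abs_def] by measurable

text \<open>At a finite limit the values are eventually finite and the real exponential takes over.
  At an infinite limit the values eventually exceed any bound, so the exponentials fall below any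
  positive \<open>e\<close>.\<close>

lemma tendsto_exp_neg:
  assumes "(f \<longlongrightarrow> a) F"
  shows "((\<lambda>x. exp_neg (f x)) \<longlongrightarrow> exp_neg a) F"
proof (cases a)
  case (real r)
  have fin: "\<forall>\<^sub>F x in F. f x < \<infinity>"
    using order_tendstoD(2)[OF assms, of \<infinity>] real by simp
  have "((\<lambda>x. ennreal (exp (- enn2real (f x)))) \<longlongrightarrow> ennreal (exp (- r))) F"
    by (intro tendsto_ennrealI tendsto_exp tendsto_minus tendsto_enn2real) (use assms real in simp_all)
  moreover have "\<forall>\<^sub>F x in F. ennreal (exp (- enn2real (f x))) = exp_neg (f x)"
    using fin by eventually_elim (simp add: exp_neg_def)
  ultimately have "((\<lambda>x. exp_neg (f x)) \<longlongrightarrow> ennreal (exp (- r))) F"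
    by (rule Lim_transform_eventually)
  then show ?thesis
    using real by (simp add: exp_neg_ennreal)
next
  case top
  have "\<forall>\<^sub>F x in F. exp_neg (f x) < e" if "e > 0" for e
  proof (cases "e = \<infinity>")
    case True
    have "exp_neg b < e" for b
      using exp_neg_le_1[of b] True by (auto simp: exp_neg_def)
    then show ?thesis by simp
  next
    case False
    with that obtain r where r: "e = ennreal r" "r > 0"
      by (cases e) auto
    \<comment> \<open>\<open>K\<close> lies strictly above - ln r, so that exp(-K) < r; the maximum
      with 0 keeps it nonnegative, so that \<open>ennreal\<close> does not truncate it.\<close>
    define K where "K = max 0 (- ln r) + 1"
    have "exp (- K) < exp (ln r)"
      by (subst exp_less_cancel_iff) (auto simp: K_def)
    then have K: "exp (- K) < r" "0 \<le> K" using r by (simp_all add: K_def)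
    have "\<forall>\<^sub>F x in F. f x > ennreal K"
      using order_tendstoD(1)[OF assms, of "ennreal K"] top by simp
    then show ?thesis
    proof eventually_elim
      case (elim x)
      have "exp_neg (f x) \<le> exp_neg (ennreal K)"
        using elim by (intro exp_neg_antimono) auto
      also have "\<dots> < e"
        using K r by (simp add: exp_neg_ennreal ennreal_less_iff)
      finally show ?case .
    qed
  qed
  then show ?thesis
    using top by (auto intro!: order_tendstoI)
qed

lemma one_minus_exp_neg_ennreal:
  "0 \<le> r \<Longrightarrow> 1 - exp_neg (ennreal r) = ennreal (1 - exp (- r))"
  by (simp add: exp_neg_ennreal ennreal_minus flip: ennreal_1)

lemma two_power_ennreal: "(2::ennreal) ^ j = ennreal (2 ^ j)"
  by (simp flip: ennreal_power)

text \<open>The difference quotient of \<open>t \<mapsto> 1 - e\<^bsup>-ta\<^esup>\<close> along \<open>t = 2\<^bsup>-j\<^esup>\<close>, which increases to \<open>a\<close>.\<close>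
definition exp_quot :: "nat \<Rightarrow> ennreal \<Rightarrow> ennreal" where
  "exp_quot j a = 2 ^ j * (1 - exp_neg (a / 2 ^ j))"

lemma exp_quot_ennreal:
  "0 \<le> r \<Longrightarrow> exp_quot j (ennreal r) = ennreal (2 ^ j * (1 - exp (- (r / 2 ^ j))))"
  unfolding exp_quot_def two_power_ennreal
  by (simp add: divide_ennreal one_minus_exp_neg_ennreal ennreal_mult'[symmetric])

lemma exp_quot_top: "exp_quot j \<infinity> = 2 ^ j"
  by (simp add: exp_quot_def ennreal_top_divide two_power_ennreal)

lemma exp_quot_measurable [measurable]: "exp_quot j \<in> borel_measurable borel"
  unfolding exp_quot_def[abs_def] by measurable

lemma exp_quot_le: "exp_quot j a \<le> a"
proof (cases a)
  case (real r)
  have "1 - r / 2 ^ j \<le> exp (- (r / 2 ^ j))"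
    using exp_ge_add_one_self[of "- (r / 2 ^ j)"] by simp
  then show ?thesis
    using real by (auto simp: exp_quot_ennreal field_simps intro!: ennreal_leI)
qed simp

text \<open>Dyadic steps make consecutive quotients comparable by squaring: with b the exponential
  at the halved step, the claim is 1 - b^2 <= 2 (1 - b), that is (1 - b)^2 >= 0. At infinity the
  quotient is 2^j.\<close>

lemma incseq_exp_quot: "incseq (\<lambda>j. exp_quot j a)"
proof (rule incseq_SucI)
  fix j
  show "exp_quot j a \<le> exp_quot (Suc j) a"
  proof (cases a)
    case (real r)
    define b where "b = exp (- (r / 2 ^ Suc j))"
    have b: "exp (- (r / 2 ^ j)) = b\<^sup>2"
      by (simp add: b_def power2_eq_square exp_add[symmetric])
    have "0 \<le> (1 - b)\<^sup>2" by simp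
    then have "1 - b\<^sup>2 \<le> 2 * (1 - b)" by (simp add: power2_eq_square algebra_simps)
    then have "2 ^ j * (1 - b\<^sup>2) \<le> 2 ^ j * (2 * (1 - b))"
      by (intro mult_left_mono) auto
    then show ?thesis
      using real by (simp add: exp_quot_ennreal b flip: b_def) (auto intro!: ennreal_leI simp: b b_def algebra_simps)
  next
    case top
    then show ?thesis
      using mult_right_mono[of 1 2 "2 ^ j :: ennreal"] by (simp add: exp_quot_top[unfolded infinity_ennreal_def])
  qed
qed

text \<open>The argument varies with j because the induction step applies this to an integral that
  is itself formed at step 2^-j. The quotient is squeezed between b - b^2 / 2^(j+1) and b.\<close>

lemma exp_quot_tendsto_aux:
  fixes b :: "nat \<Rightarrow> real"
  assumes b: "b \<longlonglongrightarrow> r" and pos: "\<And>j. 0 \<le> b j"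
  shows "(\<lambda>j. 2 ^ j * (1 - exp (- (b j / 2 ^ j)))) \<longlonglongrightarrow> r"
proof (rule tendsto_sandwich)
  have le: "u - u\<^sup>2 / 2 \<le> 1 - exp (- u)" if "0 \<le> u" for u :: real
  proof -
    have "exp (- u) \<le> 1 - u + u\<^sup>2 / 2"
    proof -
      \<comment> \<open>The product equals 1 + u^4 / 4, and its second factor is the quadratic
        Taylor lower bound of exp u.\<close>
      have "1 \<le> (1 - u + u\<^sup>2 / 2) * (1 + u + u\<^sup>2 / 2)"
        using that by (simp add: algebra_simps power2_eq_square)
      also have "\<dots> \<le> (1 - u + u\<^sup>2 / 2) * exp u"
      proof (intro mult_left_mono)
        have "0 \<le> (1 - u)\<^sup>2 / 2 + 1 / 2" by simp
        then show "0 \<le> 1 - u + u\<^sup>2 / 2" by (simp add: power2_eq_square field_simps)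
      qed (use exp_lower_Taylor_quadratic[OF that] in simp)
      finally show ?thesis
        by (simp add: exp_minus field_simps)
    qed
    then show ?thesis by simp
  qed
  show "\<forall>\<^sub>F j in sequentially. b j - (b j)\<^sup>2 / 2 ^ Suc j \<le> 2 ^ j * (1 - exp (- (b j / 2 ^ j)))"
  proof (intro always_eventually allI)
    fix j
    have "2 ^ j * (b j / 2 ^ j - (b j / 2 ^ j)\<^sup>2 / 2) \<le> 2 ^ j * (1 - exp (- (b j / 2 ^ j)))"
      using le[of "b j / 2 ^ j"] pos by (intro mult_left_mono) auto
    moreover have "2 ^ j * (b j / 2 ^ j - (b j / 2 ^ j)\<^sup>2 / 2) = b j - (b j)\<^sup>2 / 2 ^ Suc j"
      by (simp add: power2_eq_square field_simps)
    ultimately show "b j - (b j)\<^sup>2 / 2 ^ Suc j \<le> 2 ^ j * (1 - exp (- (b j / 2 ^ j)))"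
      by simp
  qed
  show "\<forall>\<^sub>F j in sequentially. 2 ^ j * (1 - exp (- (b j / 2 ^ j))) \<le> b j"
  proof (intro always_eventually allI)
    fix j
    have "1 - b j / 2 ^ j \<le> exp (- (b j / 2 ^ j))"
      using exp_ge_add_one_self[of "- (b j / 2 ^ j)"] by simp
    then show "2 ^ j * (1 - exp (- (b j / 2 ^ j))) \<le> b j"
      by (simp add: field_simps)
  qed
  have "(\<lambda>j. b j - (b j)\<^sup>2 * (1 / 2) ^ Suc j) \<longlonglongrightarrow> r - r\<^sup>2 * 0"
    by (intro tendsto_intros b LIMSEQ_Suc LIMSEQ_realpow_zero) auto
  then show "(\<lambda>j. b j - (b j)\<^sup>2 / 2 ^ Suc j) \<longlonglongrightarrow> r"
    by (simp add: power_divide)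
qed (rule b)

lemma tendsto_exp_quot:
  assumes b: "b \<longlonglongrightarrow> ennreal r" and "0 \<le> r" "\<And>j. b j < \<infinity>"
  shows "(\<lambda>j. exp_quot j (b j)) \<longlonglongrightarrow> ennreal r"
proof -
  have "(\<lambda>j. enn2real (b j)) \<longlonglongrightarrow> r"
    using b \<open>0 \<le> r\<close> by (intro tendsto_enn2real) auto
  then have "(\<lambda>j. 2 ^ j * (1 - exp (- (enn2real (b j) / 2 ^ j)))) \<longlonglongrightarrow> r"
    by (rule exp_quot_tendsto_aux) simp
  then have "(\<lambda>j. ennreal (2 ^ j * (1 - exp (- (enn2real (b j) / 2 ^ j))))) \<longlonglongrightarrow> ennreal r"
    by (rule tendsto_ennrealI)
  also have "(\<lambda>j. ennreal (2 ^ j * (1 - exp (- (enn2real (b j) / 2 ^ j))))) = (\<lambda>j. exp_quot j (b j))"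
    using assms(3) by (auto simp flip: exp_quot_ennreal)
  finally show ?thesis .
qed

text \<open>Infinite arguments are included since the exponent summed over the points may be
  infinite; there the quotients 2^j are unbounded.\<close>

lemma SUP_exp_quot: "(SUP j. exp_quot j a) = a"
proof (rule LIMSEQ_unique[OF LIMSEQ_SUP[OF incseq_exp_quot]])
  show "(\<lambda>j. exp_quot j a) \<longlonglongrightarrow> a"
  proof (cases a)
    case (real r)
    then show ?thesis using tendsto_exp_quot[of "\<lambda>_. a" r] by simp
  next
    case top
    have "(\<lambda>j. ennreal (2 ^ j)) \<longlonglongrightarrow> top"
      unfolding ennreal_tendsto_top_eq_at_top by (rule filterlim_at_infinity_imp_filterlim_at_top[OF filterlim_realpow_sequentially_gt1]) auto
    then show ?thesis
      using top by (simp add: exp_quot_top[unfolded infinity_ennreal_def] flip: ennreal_power)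
  qed
qed

section \<open>Laplace functional of a Poisson process\<close>

text \<open>Convergence to \<open>u\<close> is known on the space only. The pointwise supremum is a
  limit everywhere and agrees with \<open>u\<close> on the space, so it has the same
  integral.\<close>

lemma nn_integral_LIMSEQ_on_space:
  fixes f :: "nat \<Rightarrow> 'a \<Rightarrow> ennreal"
  assumes "incseq f" "\<And>i. f i \<in> borel_measurable M"
    and lim: "\<And>x. x \<in> space M \<Longrightarrow> (\<lambda>i. f i x) \<longlonglongrightarrow> u x"
  shows "(\<lambda>i. integral\<^sup>N M (f i)) \<longlonglongrightarrow> integral\<^sup>N M u"
proof -
  have sup: "(\<lambda>i. f i x) \<longlonglongrightarrow> (SUP i. f i x)" for x
    using assms(1) by (intro LIMSEQ_SUP) (auto simp: incseq_def le_fun_def)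
  have "(\<lambda>i. integral\<^sup>N M (f i)) \<longlonglongrightarrow> (\<integral>\<^sup>+x. (SUP i. f i x) \<partial>M)"
    by (rule nn_integral_LIMSEQ) (use assms(1,2) sup in auto)
  also have "(\<integral>\<^sup>+x. (SUP i. f i x) \<partial>M) = integral\<^sup>N M u"
    by (intro nn_integral_cong LIMSEQ_unique[OF sup lim])
  finally show ?thesis .
qed

text \<open>An enumeration of \<open>I\<close> turns the integral into a series. This covers sums
  over tuples of indices as well as over single indices.\<close>

lemma borel_measurable_nn_integral_count_space:
  fixes f :: "'i \<Rightarrow> 'a \<Rightarrow> ennreal"
  assumes "countable I" and "\<And>i. i \<in> I \<Longrightarrow> f i \<in> borel_measurable M"
  shows "(\<lambda>x. \<integral>\<^sup>+i. f i x \<partial>count_space I) \<in> borel_measurable M"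
proof (cases "finite I")
  case True
  then show ?thesis
    using assms by (simp add: nn_integral_count_space_finite)
next
  case False
  with assms have b: "bij_betw (from_nat_into I) UNIV I"
    by (intro bij_betw_from_nat_into) auto
  have "(\<integral>\<^sup>+i. f i x \<partial>count_space I) = (\<Sum>n. f (from_nat_into I n) x)" for x
    using nn_integral_bij_count_space[OF b, of "\<lambda>i. f i x"] by (simp add: nn_integral_count_space_nat)
  moreover have "f (from_nat_into I n) \<in> borel_measurable M" for n
    using False by (intro assms from_nat_into) auto
  ultimately show ?thesis by simp
qed

context prob_space
begin

text \<open>This is the generating function of the Poisson law at e^-r. A priori \<open>N\<close>
  takes arbitrary extended values; since the Poisson weights add up to 1, it is almost surely a
  natural number and the expectation becomes a series.\<close>

lemma nn_integral_exp_neg_poisson: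
  fixes N :: "'a \<Rightarrow> ennreal" and m r :: real
  assumes [measurable]: "N \<in> borel_measurable M"
    and N: "\<And>k::nat. prob {\<omega> \<in> space M. N \<omega> = of_nat k} = exp (- m) * m ^ k / fact k"
    and "0 \<le> m" "0 \<le> r"
  shows "(\<integral>\<^sup>+\<omega>. exp_neg (ennreal r * N \<omega>) \<partial>M) = exp_neg ((1 - exp_neg (ennreal r)) * ennreal m)"
proof -
  define A where "A k = {\<omega> \<in> space M. N \<omega> = of_nat k}" for k :: nat
  have [measurable]: "A k \<in> events" for k
    unfolding A_def by measurable
  have disj: "disjoint_family A"
    by (auto simp: disjoint_family_on_def A_def)
  have sums: "(\<lambda>k. (exp (- r)) ^ k * (exp (- m) * m ^ k / fact k)) sums exp (- (m * (1 - exp (- r))))" for r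
  proof -
    have "(\<lambda>k. exp (- m) * ((m * exp (- r)) ^ k /\<^sub>R fact k)) sums (exp (- m) * exp (m * exp (- r)))"
      by (intro sums_mult exp_converges)
    moreover have "exp (- m) * ((m * exp (- r)) ^ k /\<^sub>R fact k) = (exp (- r)) ^ k * (exp (- m) * m ^ k / fact k)" for k
      by (simp add: power_mult_distrib field_simps)
    moreover have "exp (- m) * exp (m * exp (- r)) = exp (- (m * (1 - exp (- r))))"
      by (simp only: exp_add[symmetric]) (simp add: algebra_simps)
    ultimately show ?thesis
      by simp
  qed
  have "(\<lambda>k. prob (A k)) sums prob (\<Union>k. A k)"
    by (intro finite_measure_UNION disj) auto
  \<comment> \<open>At r = 0 the generating function is the total mass of the weights.\<close>
  moreover have "(\<lambda>k. prob (A k)) sums 1"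
    using sums[of 0] by (simp add: A_def N)
  ultimately have "prob (\<Union>k. A k) = 1"
    by (rule sums_unique2)
  then have ae: "AE \<omega> in M. \<omega> \<in> (\<Union>k. A k)"
    by (subst (asm) prob_eq_1) auto
  have "(\<integral>\<^sup>+\<omega>. exp_neg (ennreal r * N \<omega>) \<partial>M) =
      (\<integral>\<^sup>+\<omega>. (\<Sum>k. exp_neg (ennreal r * of_nat k) * indicator (A k) \<omega>) \<partial>M)"
  proof (rule nn_integral_cong_AE, use ae in eventually_elim)
    case (elim \<omega>)
    then obtain k where k: "\<omega> \<in> A k" by auto
    have "(\<Sum>k. exp_neg (ennreal r * of_nat k) * indicator (A k) \<omega>) =
        (\<Sum>k'\<in>{k}. exp_neg (ennreal r * of_nat k') * indicator (A k') \<omega>)"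
    proof (intro suminf_finite)
      fix k' assume "k' \<notin> {k}"
      then have "\<omega> \<notin> A k'"
        using k disj by (auto simp: disjoint_family_on_def)
      then show "exp_neg (ennreal r * of_nat k') * indicator (A k') \<omega> = 0" by simp
    qed simp
    moreover have "N \<omega> = of_nat k" using k by (simp add: A_def)
    ultimately show ?case using k by simp
  qed
  also have "\<dots> = (\<Sum>k. exp_neg (ennreal r * of_nat k) * emeasure M (A k))"
    by (subst nn_integral_suminf) (auto simp: nn_integral_cmult_indicator)
  also have "\<dots> = (\<Sum>k. ennreal ((exp (- r)) ^ k * (exp (- m) * m ^ k / fact k)))"
  proof (intro suminf_cong)
    fix k
    have "exp_neg (ennreal r * of_nat k) = ennreal ((exp (- r)) ^ k)"
      using \<open>0 \<le> r\<close>
      by (simp add: ennreal_of_nat_eq_real_of_nat ennreal_mult'[symmetric] exp_neg_ennreal exp_of_nat_mult[symmetric] mult.commute)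
    then show "exp_neg (ennreal r * of_nat k) * emeasure M (A k) =
        ennreal ((exp (- r)) ^ k * (exp (- m) * m ^ k / fact k))"
      using N[of k] \<open>0 \<le> m\<close> by (simp add: emeasure_eq_measure A_def ennreal_mult''[symmetric])
  qed
  also have "\<dots> = ennreal (exp (- (m * (1 - exp (- r)))))"
    using \<open>0 \<le> m\<close> by (intro suminf_ennreal_eq sums) auto
  also have "\<dots> = exp_neg ((1 - exp_neg (ennreal r)) * ennreal m)"
    using \<open>0 \<le> m\<close> \<open>0 \<le> r\<close> unfolding one_minus_exp_neg_ennreal[OF \<open>0 \<le> r\<close>]
    by (simp add: ennreal_mult'[symmetric] exp_neg_ennreal mult.commute)
  finally show ?thesis .
qed

end

lemma point_count_eq: "point_count X A \<omega> = (\<integral>\<^sup>+l. indicator A (X l \<omega>) \<partial>count_space UNIV)"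
proof -
  have "(\<integral>\<^sup>+l. indicator A (X l \<omega>) \<partial>count_space UNIV) =
      (\<integral>\<^sup>+l. indicator {l. X l \<omega> \<in> A} l \<partial>count_space UNIV)"
    by (intro nn_integral_cong) (auto simp: indicator_def)
  then show ?thesis by (simp add: point_count_def)
qed

text \<open>The level 0 is omitted because its set may have infinite intensity, where no Poisson
  probabilities are given. Both later choices, u y = y and u y = 1 - e^-y, vanish at 0.\<close>

lemma sum_level_sets:
  fixes f :: "'a \<Rightarrow> ennreal" and u :: "ennreal \<Rightarrow> ennreal"
  assumes "finite (f ` S)" "u 0 = 0" "x \<in> S"
  shows "(\<Sum>y\<in>f ` S - {0}. u y * indicator (f -` {y} \<inter> S) x) = u (f x)"
proof -
  have "(\<Sum>y\<in>f ` S - {0}. u y * indicator (f -` {y} \<inter> S) x) = (\<Sum>y\<in>f ` S - {0}. if y = f x then u y else 0)"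
    using assms by (intro sum.cong) (auto simp: indicator_def)
  also have "\<dots> = u (f x)"
    using assms by (subst sum.delta) auto
  finally show ?thesis .
qed

locale poisson_points = prob_space M + sigma_finite_measure \<mu>
  for M :: "'w measure" and \<mu> :: "'a measure" +
  fixes X :: "nat \<Rightarrow> 'w \<Rightarrow> 'a"
  assumes poisson: "poisson_enumeration M \<mu> X"
begin

lemma X_measurable [measurable]: "X l \<in> measurable M \<mu>"
  using poisson by (simp add: poisson_enumeration_def)

lemma X_space: "\<omega> \<in> space M \<Longrightarrow> X l \<omega> \<in> space \<mu>"
  using X_measurable by (rule measurable_space)

lemma point_count_measurable [measurable]: "A \<in> sets \<mu> \<Longrightarrow> point_count X A \<in> borel_measurable M"
  unfolding point_count_eq[abs_def]
  by (intro borel_measurable_nn_integral_count_space) auto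

lemma count_integral_measurable [measurable]:
  "f \<in> borel_measurable \<mu> \<Longrightarrow> (\<lambda>\<omega>. \<integral>\<^sup>+l. f (X l \<omega>) \<partial>count_space L) \<in> borel_measurable M"
  by (intro borel_measurable_nn_integral_count_space) auto

text \<open>The sum over the points is a linear combination of the counts in the level sets. These
  sets are disjoint, so the counts are independent and the expectation factorises into Poisson
  generating functions. Support in \<open>B\<close> gives every nonzero level a finite
  intensity.\<close>

lemma laplace_functional_simple:
  assumes f: "simple_function \<mu> f" and fin: "\<And>x. f x < top"
    and supp: "\<And>x. x \<in> space \<mu> \<Longrightarrow> f x \<noteq> 0 \<Longrightarrow> x \<in> B" and B: "B \<in> sets \<mu>" "emeasure \<mu> B < \<infinity>"
  shows "(\<integral>\<^sup>+\<omega>. exp_neg (\<integral>\<^sup>+l. f (X l \<omega>) \<partial>count_space UNIV) \<partial>M) =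
    exp_neg (\<integral>\<^sup>+x. 1 - exp_neg (f x) \<partial>\<mu>)"
proof -
  define V where "V = f ` space \<mu> - {0}"
  define A where "A y = f -` {y} \<inter> space \<mu>" for y
  have finV: "finite (f ` space \<mu>)" "finite V"
    using f by (auto simp: simple_function_def V_def)
  have A: "A y \<in> sets \<mu>" for y
    unfolding A_def using f by (rule simple_functionD(2))
  have A_fin: "emeasure \<mu> (A y) < \<infinity>" if "y \<in> V" for y
  proof -
    have "A y \<subseteq> B" using supp that by (auto simp: A_def V_def)
    then show ?thesis using emeasure_mono[of "A y" B \<mu>] B by (auto intro: le_less_trans)
  qed
  \<comment> \<open>Independence of counts is given for families indexed by an initial segment of
    the naturals, so the nonzero values are numbered by \<open>h\<close>.\<close>
  obtain h where h: "bij_betw h {..<card V} V"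
    using ex_bij_betw_nat_finite[OF finV(2)] by (auto simp: atLeast0LessThan)
  have hV: "h i \<in> V" if "i < card V" for i
    using h that by (auto simp: bij_betw_def)
  have h_inj: "h i = h j \<longleftrightarrow> i = j" if "i < card V" "j < card V" for i j
    using h that by (auto simp: bij_betw_def inj_on_def)
  have disj: "disjoint_family_on (\<lambda>i. A (h i)) {..<card V}"
    using h_inj by (auto simp: disjoint_family_on_def A_def)
  have ind: "indep_vars (\<lambda>_. borel) (\<lambda>i. point_count X (A (h i))) {..<card V}"
  proof -
    have "\<forall>(m::nat) A. (\<forall>i<m. A i \<in> sets \<mu>) \<longrightarrow> disjoint_family_on A {..<m} \<longrightarrow>
        indep_vars (\<lambda>_. borel) (\<lambda>i. point_count X (A i)) {..<m}"
      using poisson by (simp add: poisson_enumeration_def)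
    from this[rule_format, of "card V" "\<lambda>i. A (h i)"] show ?thesis
      using disj A by simp
  qed
  have one: "(\<integral>\<^sup>+\<omega>. exp_neg (y * point_count X (A y) \<omega>) \<partial>M) = exp_neg ((1 - exp_neg y) * emeasure \<mu> (A y))"
    if "y \<in> V" for y
  proof -
    have y: "y = ennreal (enn2real y)"
      using fin that by (auto simp: V_def)
    have m: "emeasure \<mu> (A y) = ennreal (measure \<mu> (A y))"
      using A_fin[OF that] by (intro emeasure_eq_ennreal_measure) auto
    show ?thesis
      unfolding m
    proof (subst (1 2) y, rule nn_integral_exp_neg_poisson)
      show "prob {\<omega> \<in> space M. point_count X (A y) \<omega> = of_nat k} =
          exp (- measure \<mu> (A y)) * measure \<mu> (A y) ^ k / fact k" for k
        using poisson A A_fin[OF that] by (simp add: poisson_enumeration_def)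
    qed (use A in auto)
  qed
  have "(\<integral>\<^sup>+\<omega>. exp_neg (\<integral>\<^sup>+l. f (X l \<omega>) \<partial>count_space UNIV) \<partial>M) =
      (\<integral>\<^sup>+\<omega>. (\<Prod>i<card V. exp_neg (h i * point_count X (A (h i)) \<omega>)) \<partial>M)"
  proof (rule nn_integral_cong)
    fix \<omega> assume "\<omega> \<in> space M"
    then have "(\<integral>\<^sup>+l. f (X l \<omega>) \<partial>count_space UNIV) =
        (\<integral>\<^sup>+l. (\<Sum>y\<in>V. y * indicator (A y) (X l \<omega>)) \<partial>count_space UNIV)"
      using sum_level_sets[of f "space \<mu>" "\<lambda>y. y"] finV X_space
      by (intro nn_integral_cong) (auto simp: V_def A_def)
    also have "\<dots> = (\<Sum>y\<in>V. y * point_count X (A y) \<omega>)"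
      by (subst nn_integral_sum) (auto simp: nn_integral_cmult point_count_eq)
    also have "\<dots> = (\<Sum>i<card V. h i * point_count X (A (h i)) \<omega>)"
      using h by (rule sum.reindex_bij_betw[symmetric])
    finally show "exp_neg (\<integral>\<^sup>+l. f (X l \<omega>) \<partial>count_space UNIV) =
        (\<Prod>i<card V. exp_neg (h i * point_count X (A (h i)) \<omega>))"
      by (simp add: exp_neg_sum)
  qed
  also have "\<dots> = (\<Prod>i<card V. \<integral>\<^sup>+\<omega>. exp_neg (h i * point_count X (A (h i)) \<omega>) \<partial>M)"
    by (intro indep_vars_nn_integral indep_vars_compose2[OF ind]) auto
  also have "\<dots> = (\<Prod>i<card V. exp_neg ((1 - exp_neg (h i)) * emeasure \<mu> (A (h i))))"
    using one hV by (intro prod.cong) auto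
  also have "\<dots> = (\<Prod>y\<in>V. exp_neg ((1 - exp_neg y) * emeasure \<mu> (A y)))"
    using h by (rule prod.reindex_bij_betw)
  also have "\<dots> = exp_neg (\<Sum>y\<in>V. (1 - exp_neg y) * emeasure \<mu> (A y))"
    by (simp add: exp_neg_sum)
  also have "(\<Sum>y\<in>V. (1 - exp_neg y) * emeasure \<mu> (A y)) = (\<integral>\<^sup>+x. (\<Sum>y\<in>V. (1 - exp_neg y) * indicator (A y) x) \<partial>\<mu>)"
    using A by (subst nn_integral_sum) (auto simp: nn_integral_cmult_indicator)
  also have "\<dots> = (\<integral>\<^sup>+x. 1 - exp_neg (f x) \<partial>\<mu>)"
    using sum_level_sets[of f "space \<mu>" "\<lambda>y. 1 - exp_neg y"] finV
    by (intro nn_integral_cong) (auto simp: V_def A_def)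
  finally show ?thesis .
qed

text \<open>Simple functions cut off to sets of finite intensity increase to \<open>f\<close>. Sums
  and integrals inside the exponentials converge monotonically; the outer expectation converges by
  domination, as \<open>exp_neg\<close> is at most 1.\<close>

theorem laplace_functional:
  assumes f [measurable]: "f \<in> borel_measurable \<mu>"
  shows "(\<integral>\<^sup>+\<omega>. exp_neg (\<integral>\<^sup>+l. f (X l \<omega>) \<partial>count_space UNIV) \<partial>M) =
    exp_neg (\<integral>\<^sup>+x. 1 - exp_neg (f x) \<partial>\<mu>)"
proof -
  obtain B where B: "range B \<subseteq> sets \<mu>" "(\<Union>i. B i) = space \<mu>" "\<And>i. emeasure \<mu> (B i) \<noteq> \<infinity>" "incseq B"
    using sigma_finite_incseq by metis
  obtain s where s: "\<And>i. simple_function \<mu> (s i)" "incseq s" "\<And>i x. s i x < top" "\<And>x. (SUP i. s i x) = f x"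
    using borel_measurable_implies_simple_function_sequence'[OF f] by metis
  define g where "g i x = s i x * indicator (B i) x" for i x
  have sg: "simple_function \<mu> (g i)" for i
    unfolding g_def using B s by auto
  have gm [measurable]: "g i \<in> borel_measurable \<mu>" for i
    using sg by (rule borel_measurable_simple_function)
  have inc: "incseq g"
    using s(2) B(4) by (fastforce simp: g_def incseq_def le_fun_def split: split_indicator)
  have lim: "(\<lambda>i. g i x) \<longlonglongrightarrow> f x" if x: "x \<in> space \<mu>" for x
  proof -
    obtain i0 where i0: "x \<in> B i0" using B(2) x by blast
    have "(\<lambda>i. s i x) \<longlonglongrightarrow> f x"
      using s(2) LIMSEQ_SUP[of "\<lambda>i. s i x"] by (auto simp: incseq_def le_fun_def s(4))
    moreover have "\<forall>\<^sub>F i in sequentially. s i x = g i x"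
      using eventually_ge_at_top[of i0]
      by eventually_elim (use i0 B(4) in \<open>auto simp: g_def incseq_def split: split_indicator\<close>)
    ultimately show ?thesis by (rule Lim_transform_eventually)
  qed
  have eq: "(\<integral>\<^sup>+\<omega>. exp_neg (\<integral>\<^sup>+l. g i (X l \<omega>) \<partial>count_space UNIV) \<partial>M) =
    exp_neg (\<integral>\<^sup>+x. 1 - exp_neg (g i x) \<partial>\<mu>)" for i
    by (rule laplace_functional_simple[where B="B i", OF sg])
      (use s(3) B in \<open>auto simp: g_def less_top[symmetric] indicator_def split: if_splits\<close>)
  have "(\<lambda>i. \<integral>\<^sup>+\<omega>. exp_neg (\<integral>\<^sup>+l. g i (X l \<omega>) \<partial>count_space UNIV) \<partial>M) \<longlonglongrightarrow>
      (\<integral>\<^sup>+\<omega>. exp_neg (\<integral>\<^sup>+l. f (X l \<omega>) \<partial>count_space UNIV) \<partial>M)"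
  proof (rule nn_integral_dominated_convergence[where w="\<lambda>_. 1"])
    show "AE \<omega> in M. (\<lambda>i. exp_neg (\<integral>\<^sup>+l. g i (X l \<omega>) \<partial>count_space UNIV)) \<longlonglongrightarrow>
        exp_neg (\<integral>\<^sup>+l. f (X l \<omega>) \<partial>count_space UNIV)"
    proof (intro AE_I2 tendsto_exp_neg nn_integral_LIMSEQ)
      fix \<omega> l assume "\<omega> \<in> space M"
      then show "(\<lambda>i. g i (X l \<omega>)) \<longlonglongrightarrow> f (X l \<omega>)"
        by (intro lim X_space)
    qed (use inc in \<open>auto simp: incseq_def le_fun_def\<close>)
  qed (simp_all add: exp_neg_le_1 emeasure_space_1)
  moreover have "(\<lambda>i. exp_neg (\<integral>\<^sup>+x. 1 - exp_neg (g i x) \<partial>\<mu>)) \<longlonglongrightarrow> exp_neg (\<integral>\<^sup>+x. 1 - exp_neg (f x) \<partial>\<mu>)"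
  proof (intro tendsto_exp_neg nn_integral_LIMSEQ_on_space)
    show "incseq (\<lambda>i x. 1 - exp_neg (g i x))"
      using inc by (auto simp: incseq_def le_fun_def intro!: ennreal_minus_mono exp_neg_antimono)
    fix x assume "x \<in> space \<mu>"
    then show "(\<lambda>i. 1 - exp_neg (g i x)) \<longlonglongrightarrow> 1 - exp_neg (f x)"
      by (intro tendsto_diff_ennreal tendsto_const tendsto_exp_neg lim) auto
  qed auto
  ultimately show ?thesis
    unfolding eq by (rule LIMSEQ_unique)
qed

end

section \<open>Multivariate Mecke formula\<close>

definition inj_lists :: "nat \<Rightarrow> nat list set" where
  "inj_lists k = {ls. length ls = k \<and> distinct ls}"

lemma inj_lists_0: "inj_lists 0 = {[]}"
  by (auto simp: inj_lists_def)

text \<open>Appending at the end leaves earlier entries in place, so entry \<open>i\<close> stays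
  paired with the weight \<open>g i\<close> throughout the induction.\<close>

lemma bij_betw_inj_lists_Suc:
  "bij_betw (\<lambda>(ls, l). ls @ [l]) (Sigma (inj_lists k) (\<lambda>ls. - set ls)) (inj_lists (Suc k))"
  unfolding bij_betw_def
proof (intro conjI set_eqI iffI)
  show "inj_on (\<lambda>(ls, l). ls @ [l]) (Sigma (inj_lists k) (\<lambda>ls. - set ls))"
    by (auto simp: inj_on_def)
next
  fix ls assume ls: "ls \<in> inj_lists (Suc k)"
  then have "ls \<noteq> []" by (auto simp: inj_lists_def)
  then obtain xs x where "ls = xs @ [x]"
    by (cases ls rule: rev_cases) auto
  with ls show "ls \<in> (\<lambda>(ls, l). ls @ [l]) ` Sigma (inj_lists k) (\<lambda>ls. - set ls)"
    by (auto simp: inj_lists_def image_iff)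
qed (auto simp: inj_lists_def)

lemma nn_integral_inj_lists_Suc:
  "(\<integral>\<^sup>+ls. F ls \<partial>count_space (inj_lists (Suc k))) =
    (\<integral>\<^sup>+ls. \<integral>\<^sup>+l. F (ls @ [l]) \<partial>count_space (- set ls) \<partial>count_space (inj_lists k))"
proof -
  let ?S = "Sigma (inj_lists k) (\<lambda>ls. - set ls)"
  have "(\<integral>\<^sup>+ls. \<integral>\<^sup>+l. F (ls @ [l]) \<partial>count_space (- set ls) \<partial>count_space (inj_lists k)) =
      (\<integral>\<^sup>+ls. \<integral>\<^sup>+l. F (ls @ [l]) * indicator ?S (ls, l) \<partial>count_space UNIV \<partial>count_space UNIV)"
    by (subst (1 2) nn_integral_count_space_indicator, simp, simp, rule nn_integral_cong)
      (auto simp: indicator_def intro!: nn_integral_cong)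
  also have "\<dots> = (\<integral>\<^sup>+p. F (fst p @ [snd p]) * indicator ?S p \<partial>count_space UNIV)"
    using nn_integral_fst_count_space[of "\<lambda>p. F (fst p @ [snd p]) * indicator ?S p"] by simp
  also have "\<dots> = (\<integral>\<^sup>+p. F (case p of (ls, l) \<Rightarrow> ls @ [l]) \<partial>count_space ?S)"
    by (subst (2) nn_integral_count_space_indicator) (auto simp: split_def)
  also have "\<dots> = (\<integral>\<^sup>+ls. F ls \<partial>count_space (inj_lists (Suc k)))"
    by (rule nn_integral_bij_count_space[OF bij_betw_inj_lists_Suc])
  finally show ?thesis ..
qed

definition rest_exp :: "('a \<Rightarrow> real) \<Rightarrow> (nat \<Rightarrow> 'a) \<Rightarrow> nat set \<Rightarrow> ennreal" where
  "rest_exp f x L = exp_neg (\<integral>\<^sup>+l. ennreal (f (x l)) \<partial>count_space (- L))"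

text \<open>For \<open>f\<close> = 0 this integrates a product function against the k-th factorial
  measure of the points; a general \<open>f\<close> adds the exponential needed for
  differentiation.\<close>

definition tuple_sum :: "nat \<Rightarrow> (nat \<Rightarrow> 'a \<Rightarrow> real) \<Rightarrow> ('a \<Rightarrow> real) \<Rightarrow> (nat \<Rightarrow> 'a) \<Rightarrow> ennreal" where
  "tuple_sum k g f x =
    (\<integral>\<^sup>+ls. (\<Prod>i<k. ennreal (g i (x (ls ! i)))) * rest_exp f x (set ls) \<partial>count_space (inj_lists k))"

lemma rest_exp_insert:
  assumes "l \<notin> L" "0 \<le> f (x l)"
  shows "rest_exp f x L = ennreal (exp (- f (x l))) * rest_exp f x (insert l L)"
proof -
  have "(\<integral>\<^sup>+l. ennreal (f (x l)) \<partial>count_space (- L)) =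
      (\<integral>\<^sup>+k. ennreal (f (x k)) * indicator (- insert l L) k + ennreal (f (x l)) * indicator {l} k \<partial>count_space UNIV)"
    using assms by (subst nn_integral_count_space_indicator) (auto intro!: nn_integral_cong split: split_indicator)
  also have "\<dots> = (\<integral>\<^sup>+l. ennreal (f (x l)) \<partial>count_space (- insert l L)) + ennreal (f (x l))"
    by (subst nn_integral_add) (auto simp: nn_integral_cmult_indicator simp flip: nn_integral_count_space_indicator)
  finally show ?thesis
    using assms by (simp add: rest_exp_def exp_neg_add exp_neg_ennreal mult.commute)
qed

lemma rest_exp_add:
  assumes "\<And>l. 0 \<le> f (x l)" "\<And>l. 0 \<le> h (x l)"
  shows "rest_exp (\<lambda>y. f y + h y / 2 ^ j) x L =
    rest_exp f x L * exp_neg ((\<integral>\<^sup>+l. ennreal (h (x l)) \<partial>count_space (- L)) / 2 ^ j)"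
proof -
  have "ennreal (f (x l) + h (x l) / 2 ^ j) = ennreal (f (x l)) + ennreal (h (x l)) / 2 ^ j" for l
    using assms[of l] by (simp add: divide_ennreal two_power_ennreal)
  then show ?thesis
    by (simp add: rest_exp_def nn_integral_add nn_integral_divide exp_neg_add)
qed

lemma prod_ennreal_less_top: "(\<Prod>i\<in>I. ennreal (u i)) < top"
  by (induction I rule: infinite_finite_induct) (auto simp: ennreal_mult_less_top)

text \<open>Additive form of the difference quotient: it can be multiplied and integrated in
  \<open>ennreal\<close> with no subtraction of possibly infinite terms.\<close>

lemma exp_quot_add: "exp_quot j a + 2 ^ j * exp_neg (a / 2 ^ j) = 2 ^ j"
proof -
  have "exp_quot j a + 2 ^ j * exp_neg (a / 2 ^ j) = 2 ^ j * ((1 - exp_neg (a / 2 ^ j)) + exp_neg (a / 2 ^ j))"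
    by (simp add: exp_quot_def distrib_left)
  then show ?thesis
    using exp_neg_le_1 by (simp add: diff_add_cancel_ennreal)
qed

lemma tuple_sum_Suc:
  assumes "\<And>l. 0 \<le> f (x l)" "\<And>i l. i \<le> k \<Longrightarrow> 0 \<le> g i (x l)"
  shows "tuple_sum (Suc k) g f x =
    (\<integral>\<^sup>+ls. (\<Prod>i<k. ennreal (g i (x (ls ! i)))) * (rest_exp f x (set ls) *
      (\<integral>\<^sup>+l. ennreal (g k (x l) * exp (f (x l))) \<partial>count_space (- set ls))) \<partial>count_space (inj_lists k))"
  unfolding tuple_sum_def nn_integral_inj_lists_Suc
proof (rule nn_integral_cong)
  fix ls assume "ls \<in> space (count_space (inj_lists k))"
  then have ls: "length ls = k" by (simp add: inj_lists_def)
  let ?P = "\<Prod>i<k. ennreal (g i (x (ls ! i)))"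
  have "(\<integral>\<^sup>+l. (\<Prod>i<Suc k. ennreal (g i (x ((ls @ [l]) ! i)))) * rest_exp f x (set (ls @ [l])) \<partial>count_space (- set ls)) =
      (\<integral>\<^sup>+l. ?P * rest_exp f x (set ls) * ennreal (g k (x l) * exp (f (x l))) \<partial>count_space (- set ls))"
  proof (rule nn_integral_cong)
    fix l assume "l \<in> space (count_space (- set ls))"
    then have r: "rest_exp f x (set ls) = ennreal (exp (- f (x l))) * rest_exp f x (insert l (set ls))"
      using assms by (intro rest_exp_insert) auto
    have "ennreal (g k (x l)) = ennreal (exp (- f (x l))) * ennreal (g k (x l) * exp (f (x l)))"
      using assms by (simp add: ennreal_mult''[symmetric] exp_minus field_simps)
    moreover have "(\<Prod>i<k. ennreal (g i (x ((ls @ [l]) ! i)))) = ?P"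
      using ls by (intro prod.cong) (auto simp: nth_append)
    moreover have "(ls @ [l]) ! k = l"
      using ls by (simp add: nth_append)
    ultimately show "(\<Prod>i<Suc k. ennreal (g i (x ((ls @ [l]) ! i)))) * rest_exp f x (set (ls @ [l])) =
        ?P * rest_exp f x (set ls) * ennreal (g k (x l) * exp (f (x l)))"
      unfolding r using ls by (simp add: mult_ac)
  qed
  then show "(\<integral>\<^sup>+l. (\<Prod>i<Suc k. ennreal (g i (x ((ls @ [l]) ! i)))) * rest_exp f x (set (ls @ [l])) \<partial>count_space (- set ls)) =
      ?P * (rest_exp f x (set ls) * (\<integral>\<^sup>+l. ennreal (g k (x l) * exp (f (x l))) \<partial>count_space (- set ls)))"
    by (simp add: nn_integral_cmult mult.assoc)
qed

context poisson_points
begin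

lemma tuple_sum_measurable [measurable]:
  assumes [measurable]: "f \<in> borel_measurable \<mu>" "\<And>i. i < k \<Longrightarrow> g i \<in> borel_measurable \<mu>"
  shows "(\<lambda>\<omega>. tuple_sum k g f (\<lambda>l. X l \<omega>)) \<in> borel_measurable M"
  unfolding tuple_sum_def rest_exp_def
  by (intro borel_measurable_nn_integral_count_space borel_measurable_times_ennreal borel_measurable_prod_ennreal
      measurable_compose[OF _ exp_neg_measurable] count_integral_measurable) (auto intro: countable_subset)

text \<open>Induction on \<open>k\<close> for all \<open>f\<close> at once: the hypothesis is used
  at f and at f + h / 2^j, and the scaled difference is passed to the limit. On the left the tuples
  gain an entry. On the right the exponent has derivative equal to the integral of e^-f h, which is
  the integral of g k, so exactly this factor appears.\<close>

theorem multivariate_mecke: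
  fixes f :: "'a \<Rightarrow> real" and g :: "nat \<Rightarrow> 'a \<Rightarrow> real"
  assumes "f \<in> borel_measurable \<mu>" "\<And>x. x \<in> space \<mu> \<Longrightarrow> 0 \<le> f x"
    and "\<And>i. i < k \<Longrightarrow> g i \<in> borel_measurable \<mu>" "\<And>i x. i < k \<Longrightarrow> x \<in> space \<mu> \<Longrightarrow> 0 \<le> g i x"
    and "\<And>i. i < k \<Longrightarrow> (\<integral>\<^sup>+x. ennreal (g i x) \<partial>\<mu>) < \<infinity>"
  shows "(\<integral>\<^sup>+\<omega>. tuple_sum k g f (\<lambda>l. X l \<omega>) \<partial>M) =
    (\<Prod>i<k. \<integral>\<^sup>+x. ennreal (g i x) \<partial>\<mu>) * exp_neg (\<integral>\<^sup>+x. 1 - exp_neg (ennreal (f x)) \<partial>\<mu>)"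
  using assms
proof (induction k arbitrary: f)
  case 0
  have "tuple_sum 0 g f x = exp_neg (\<integral>\<^sup>+l. ennreal (f (x l)) \<partial>count_space UNIV)" for x :: "nat \<Rightarrow> 'a"
    by (simp add: tuple_sum_def inj_lists_0 nn_integral_count_space_finite rest_exp_def)
  then show ?case
    using laplace_functional[of "\<lambda>x. ennreal (f x)"] 0 by simp
next
  case (Suc k)
  note [measurable] = Suc.prems(1)
  have g_meas [measurable]: "g i \<in> borel_measurable \<mu>" if "i \<le> k" for i
    using Suc.prems(3)[of i] that by simp
  have g_k [measurable]: "g k \<in> borel_measurable \<mu>" by simp
  txt \<open>The factor \<open>exp (f y)\<close> cancels the factor that the product over the unused points loses
    when the point \<open>y\<close> becomes the last entry of the tuple.\<close>
  define h where "h y = g k y * exp (f y)" for y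
  have [measurable]: "h \<in> borel_measurable \<mu>"
    unfolding h_def by measurable
  have h_nonneg: "0 \<le> h y" if "y \<in> space \<mu>" for y
    using Suc.prems(4) that by (simp add: h_def)
  define f' where "f' j y = f y + h y / 2 ^ j" for j :: nat and y
  define H where "H x L = (\<integral>\<^sup>+l. ennreal (h (x l)) \<partial>count_space (- L))" for x :: "nat \<Rightarrow> 'a" and L :: "nat set"
  \<comment> \<open>\<open>D j\<close> is 2^j times the drop of the tuple sum when f is replaced by
    \<open>f' j\<close>, written through \<open>exp_quot\<close> so that monotonicity in j is
    visible.\<close>
  define D where "D j x = (\<integral>\<^sup>+ls. (\<Prod>i<k. ennreal (g i (x (ls ! i)))) *
      (rest_exp f x (set ls) * exp_quot j (H x (set ls))) \<partial>count_space (inj_lists k))" for j x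
  let ?X = "\<lambda>\<omega> l. X l \<omega>"
  define G where "G = (\<Prod>i<k. \<integral>\<^sup>+x. ennreal (g i x) \<partial>\<mu>)"
  define A where "A = (\<integral>\<^sup>+x. 1 - exp_neg (ennreal (f x)) \<partial>\<mu>)"
  \<comment> \<open>\<open>b j\<close> is 2^j times the growth of the exponent of the Laplace
    functional when f is replaced by \<open>f' j\<close>.\<close>
  define b where "b j = (\<integral>\<^sup>+y. ennreal (exp (- f y)) * exp_quot j (ennreal (h y)) \<partial>\<mu>)" for j
  have G_fin: "G < \<infinity>"
    unfolding G_def using Suc.prems(5) by (auto simp: ennreal_prod_eq_top less_top[symmetric])

  have IH: "(\<integral>\<^sup>+\<omega>. tuple_sum k g f (?X \<omega>) \<partial>M) = G * exp_neg A"
    unfolding G_def A_def using Suc.prems by (intro Suc.IH) auto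
  have IH': "(\<integral>\<^sup>+\<omega>. tuple_sum k g (f' j) (?X \<omega>) \<partial>M) = G * (exp_neg A * exp_neg (b j / 2 ^ j))" for j
  proof -
    have "(\<integral>\<^sup>+\<omega>. tuple_sum k g (f' j) (?X \<omega>) \<partial>M) =
        G * exp_neg (\<integral>\<^sup>+x. 1 - exp_neg (ennreal (f' j x)) \<partial>\<mu>)"
      unfolding G_def using Suc.prems h_nonneg by (intro Suc.IH) (auto simp: f'_def)
    also have "(\<integral>\<^sup>+x. 1 - exp_neg (ennreal (f' j x)) \<partial>\<mu>) =
        (\<integral>\<^sup>+x. (1 - exp_neg (ennreal (f x))) + ennreal (exp (- f x)) * exp_quot j (ennreal (h x)) / 2 ^ j \<partial>\<mu>)"
    proof (rule nn_integral_cong)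
      fix x assume x: "x \<in> space \<mu>"
      have "exp (- f' j x) = exp (- f x) * exp (- (h x / 2 ^ j))"
        by (simp add: f'_def exp_add[symmetric])
      then have "1 - exp (- f' j x) = 1 - exp (- f x) + exp (- f x) * (2 ^ j * (1 - exp (- (h x / 2 ^ j)))) / 2 ^ j"
        by (simp add: right_diff_distrib diff_divide_distrib)
      moreover have "0 \<le> 1 - exp (- (h x / 2 ^ j))" "0 \<le> f' j x" "0 \<le> f x"
        using h_nonneg[OF x] Suc.prems(2)[OF x] by (auto simp: f'_def)
      ultimately show "1 - exp_neg (ennreal (f' j x)) =
          (1 - exp_neg (ennreal (f x))) + ennreal (exp (- f x)) * exp_quot j (ennreal (h x)) / 2 ^ j"
        using h_nonneg[OF x]
        by (simp add: one_minus_exp_neg_ennreal exp_quot_ennreal two_power_ennreal ennreal_mult'[symmetric] divide_ennreal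
            ennreal_plus[symmetric] del: ennreal_plus)
    qed
    also have "\<dots> = A + b j / 2 ^ j"
      by (subst nn_integral_add) (auto simp: A_def b_def nn_integral_divide)
    finally show ?thesis by (simp add: exp_neg_add)
  qed

  have D_add: "D j (?X \<omega>) + 2 ^ j * tuple_sum k g (f' j) (?X \<omega>) = 2 ^ j * tuple_sum k g f (?X \<omega>)"
    if "\<omega> \<in> space M" for j \<omega>
  proof -
    have r: "rest_exp (f' j) (?X \<omega>) L = rest_exp f (?X \<omega>) L * exp_neg (H (?X \<omega>) L / 2 ^ j)" for L
      unfolding f'_def H_def using Suc.prems(2) h_nonneg X_space[OF that] by (intro rest_exp_add) auto
    have "(\<Prod>i<k. ennreal (g i (X (ls ! i) \<omega>))) * (rest_exp f (?X \<omega>) (set ls) * exp_quot j (H (?X \<omega>) (set ls))) +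
        2 ^ j * ((\<Prod>i<k. ennreal (g i (X (ls ! i) \<omega>))) * rest_exp (f' j) (?X \<omega>) (set ls)) =
        2 ^ j * ((\<Prod>i<k. ennreal (g i (X (ls ! i) \<omega>))) * rest_exp f (?X \<omega>) (set ls))" for ls
    proof -
      let ?p = "\<Prod>i<k. ennreal (g i (X (ls ! i) \<omega>))" and ?r = "rest_exp f (?X \<omega>) (set ls)"
      have "?p * (?r * exp_quot j (H (?X \<omega>) (set ls))) + 2 ^ j * (?p * rest_exp (f' j) (?X \<omega>) (set ls)) =
          ?p * ?r * (exp_quot j (H (?X \<omega>) (set ls)) + 2 ^ j * exp_neg (H (?X \<omega>) (set ls) / 2 ^ j))"
        by (simp add: r distrib_left mult_ac)
      then show ?thesis
        by (simp only: exp_quot_add mult_ac)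
    qed
    then show ?thesis
      unfolding D_def tuple_sum_def
      by (simp add: nn_integral_cmult[symmetric] nn_integral_add[symmetric])
  qed
  have D_meas [measurable]: "(\<lambda>\<omega>. D j (?X \<omega>)) \<in> borel_measurable M" for j
    unfolding D_def rest_exp_def H_def
    by (intro borel_measurable_nn_integral_count_space borel_measurable_times_ennreal borel_measurable_prod_ennreal
        measurable_compose[OF _ exp_neg_measurable] measurable_compose[OF _ exp_quot_measurable] count_integral_measurable)
      auto
  have ts_meas: "(\<lambda>\<omega>. tuple_sum k g f (?X \<omega>)) \<in> borel_measurable M"
      "(\<lambda>\<omega>. tuple_sum k g (f' j) (?X \<omega>)) \<in> borel_measurable M" for j
    by (auto intro!: tuple_sum_measurable simp: f'_def[abs_def])
  have D_int: "(\<integral>\<^sup>+\<omega>. D j (?X \<omega>) \<partial>M) = G * exp_neg A * exp_quot j (b j)" for j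
  proof -
    \<comment> \<open>This common summand is cancelled at the end; in \<open>ennreal\<close> that
      needs it to be finite, hence \<open>G_fin\<close>.\<close>
    let ?r = "2 ^ j * (G * (exp_neg A * exp_neg (b j / 2 ^ j)))"
    have "(\<integral>\<^sup>+\<omega>. D j (?X \<omega>) \<partial>M) + ?r =
        (\<integral>\<^sup>+\<omega>. D j (?X \<omega>) + 2 ^ j * tuple_sum k g (f' j) (?X \<omega>) \<partial>M)"
      using ts_meas by (subst nn_integral_add) (auto simp: nn_integral_cmult IH')
    also have "\<dots> = 2 ^ j * (G * exp_neg A)"
      using ts_meas by (simp add: D_add nn_integral_cmult IH cong: nn_integral_cong)
    also have "\<dots> = G * exp_neg A * (exp_quot j (b j) + 2 ^ j * exp_neg (b j / 2 ^ j))"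
      by (simp only: exp_quot_add mult_ac)
    also have "\<dots> = G * exp_neg A * exp_quot j (b j) + ?r"
      by (simp add: distrib_left mult_ac)
    finally have "?r + (\<integral>\<^sup>+\<omega>. D j (?X \<omega>) \<partial>M) = ?r + G * exp_neg A * exp_quot j (b j)"
      by (simp only: add.commute)
    moreover have "?r < \<infinity>"
      using G_fin exp_neg_le_1 by (auto simp: two_power_ennreal ennreal_mult_less_top intro: le_less_trans)
    ultimately show ?thesis
      by (subst (asm) ennreal_add_left_cancel) auto
  qed

  have "(\<lambda>j. \<integral>\<^sup>+\<omega>. D j (?X \<omega>) \<partial>M) \<longlonglongrightarrow> (\<integral>\<^sup>+\<omega>. tuple_sum (Suc k) g f (?X \<omega>) \<partial>M)"
  proof (rule nn_integral_LIMSEQ_on_space)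
    show "incseq (\<lambda>j \<omega>. D j (?X \<omega>))"
      using incseq_exp_quot by (auto simp: D_def incseq_def le_fun_def intro!: nn_integral_mono mult_left_mono)
    fix \<omega> assume \<omega>: "\<omega> \<in> space M"
    have ts: "tuple_sum (Suc k) g f (?X \<omega>) = (\<integral>\<^sup>+ls. (\<Prod>i<k. ennreal (g i (X (ls ! i) \<omega>))) *
      (rest_exp f (?X \<omega>) (set ls) * H (?X \<omega>) (set ls)) \<partial>count_space (inj_lists k))"
      unfolding H_def h_def using Suc.prems X_space[OF \<omega>] by (intro tuple_sum_Suc) auto
    show "(\<lambda>j. D j (?X \<omega>)) \<longlonglongrightarrow> tuple_sum (Suc k) g f (?X \<omega>)"
      unfolding ts D_def
    proof (rule nn_integral_LIMSEQ)
      fix ls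
      have "(\<lambda>j. (\<Prod>i<k. ennreal (g i (X (ls ! i) \<omega>))) * rest_exp f (?X \<omega>) (set ls) * exp_quot j (H (?X \<omega>) (set ls)))
          \<longlonglongrightarrow> (\<Prod>i<k. ennreal (g i (X (ls ! i) \<omega>))) * rest_exp f (?X \<omega>) (set ls) * H (?X \<omega>) (set ls)"
      proof (rule ennreal_tendsto_cmult)
        show "(\<lambda>j. exp_quot j (H (?X \<omega>) (set ls))) \<longlonglongrightarrow> H (?X \<omega>) (set ls)"
          using LIMSEQ_SUP[OF incseq_exp_quot] by (simp add: SUP_exp_quot)
        show "(\<Prod>i<k. ennreal (g i (X (ls ! i) \<omega>))) * rest_exp f (?X \<omega>) (set ls) < top"
          by (simp add: ennreal_mult_less_top rest_exp_def prod_ennreal_less_top)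
      qed
      then show "(\<lambda>j. (\<Prod>i<k. ennreal (g i (X (ls ! i) \<omega>))) * (rest_exp f (?X \<omega>) (set ls) * exp_quot j (H (?X \<omega>) (set ls))))
          \<longlonglongrightarrow> (\<Prod>i<k. ennreal (g i (X (ls ! i) \<omega>))) * (rest_exp f (?X \<omega>) (set ls) * H (?X \<omega>) (set ls))"
        by (simp add: mult.assoc)
    qed (use incseq_exp_quot in \<open>auto simp: incseq_def le_fun_def intro!: mult_left_mono\<close>)
  qed auto
  \<comment> \<open>A chain rule: the inner quotients \<open>b j\<close> stay below the finite
    integral of \<open>g k\<close> and increase to it, and the outer quotient is taken at these
    moving arguments.\<close>
  moreover have "(\<lambda>j. G * exp_neg A * exp_quot j (b j)) \<longlonglongrightarrow> G * exp_neg A * (\<integral>\<^sup>+x. ennreal (g k x) \<partial>\<mu>)"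
  proof (rule ennreal_tendsto_cmult)
    show "G * exp_neg A < top"
      using G_fin le_less_trans[OF exp_neg_le_1 ennreal_one_less_top] by (simp add: ennreal_mult_less_top)
    have g_eq: "ennreal (g k y) = ennreal (exp (- f y)) * ennreal (h y)" for y
      by (simp add: h_def ennreal_mult'[symmetric] exp_minus field_simps)
    have "b \<longlonglongrightarrow> (\<integral>\<^sup>+x. ennreal (g k x) \<partial>\<mu>)"
      unfolding b_def g_eq
    proof (rule nn_integral_LIMSEQ)
      fix y
      show "(\<lambda>j. ennreal (exp (- f y)) * exp_quot j (ennreal (h y))) \<longlonglongrightarrow> ennreal (exp (- f y)) * ennreal (h y)"
        using LIMSEQ_SUP[OF incseq_exp_quot, of "ennreal (h y)"] by (intro ennreal_tendsto_cmult) (auto simp: SUP_exp_quot)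
    qed (use incseq_exp_quot in \<open>auto simp: incseq_def le_fun_def intro!: mult_left_mono\<close>)
    moreover have "b j < \<infinity>" for j
    proof -
      have "b j \<le> (\<integral>\<^sup>+x. ennreal (g k x) \<partial>\<mu>)"
        unfolding b_def g_eq by (intro nn_integral_mono mult_left_mono exp_quot_le) auto
      then show ?thesis using Suc.prems(5)[of k] by (auto intro: le_less_trans)
    qed
    moreover have "(\<integral>\<^sup>+x. ennreal (g k x) \<partial>\<mu>) = ennreal (enn2real (\<integral>\<^sup>+x. ennreal (g k x) \<partial>\<mu>))"
      using Suc.prems(5)[of k] by simp
    ultimately show "(\<lambda>j. exp_quot j (b j)) \<longlonglongrightarrow> (\<integral>\<^sup>+x. ennreal (g k x) \<partial>\<mu>)"
      using tendsto_exp_quot[of b "enn2real (\<integral>\<^sup>+x. ennreal (g k x) \<partial>\<mu>)"] by simp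
  qed
  ultimately have "(\<integral>\<^sup>+\<omega>. tuple_sum (Suc k) g f (?X \<omega>) \<partial>M) = G * exp_neg A * (\<integral>\<^sup>+x. ennreal (g k x) \<partial>\<mu>)"
    unfolding D_int by (rule LIMSEQ_unique)
  then show ?case
    by (simp add: G_def A_def mult_ac)
qed

end

section \<open>Integrals against the stable intensity\<close>

text \<open>Euler's integral after rescaling by \<open>l\<close>. It serves the representation of 1
  / S^n, the moments of the stable intensity and the final integral over t.\<close>

lemma nn_integral_Gamma_kernel:
  fixes s l :: real
  assumes s: "0 < s" and l: "0 < l"
  shows "(\<integral>\<^sup>+x. ennreal (x powr (s - 1) * exp (- (l * x))) * indicator {0<..} x \<partial>lborel) =
    ennreal (Gamma s * l powr (- s))"
proof -
  let ?I = "\<integral>\<^sup>+x. ennreal (x powr (s - 1) * exp (- (l * x))) * indicator {0<..} x \<partial>lborel"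
  have "ennreal (Gamma s) = (\<integral>\<^sup>+t. ennreal (t powr (s - 1) * exp (- t)) * indicator {0<..} t \<partial>lborel)"
    unfolding Gamma_conv_nn_integral_real[OF s]
    by (intro nn_integral_cong) (auto simp: indicator_def exp_minus field_simps)
  also have "\<dots> = ennreal l * (\<integral>\<^sup>+x. ennreal ((l * x) powr (s - 1) * exp (- (l * x))) * indicator {0<..} (l * x) \<partial>lborel)"
    using l by (subst nn_integral_real_affine[where c=l and t=0]) auto
  also have "(\<integral>\<^sup>+x. ennreal ((l * x) powr (s - 1) * exp (- (l * x))) * indicator {0<..} (l * x) \<partial>lborel) =
      (\<integral>\<^sup>+x. ennreal (l powr (s - 1)) * (ennreal (x powr (s - 1) * exp (- (l * x))) * indicator {0<..} x) \<partial>lborel)"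
    using l by (intro nn_integral_cong)
      (auto simp: indicator_def powr_mult ennreal_mult'[symmetric] zero_less_mult_iff mult_ac)
  also have "\<dots> = ennreal (l powr (s - 1)) * ?I"
    by (rule nn_integral_cmult) simp
  finally have "ennreal (Gamma s) = ennreal (l powr s) * ?I"
    using l by (simp add: mult.assoc[symmetric] ennreal_mult'[symmetric] powr_mult_base)
  then have "ennreal (l powr (- s)) * ennreal (Gamma s) = ennreal (l powr (- s) * l powr s) * ?I"
    by (simp add: mult.assoc[symmetric] ennreal_mult'[symmetric])
  then show ?thesis
    using l by (simp add: powr_add[symmetric] ennreal_mult'' mult.commute)
qed

text \<open>The substitution is made on compact intervals away from 0, where the derivative of x^a
  is continuous even if a < 1. The intervals and their images both exhaust the half-line, and
  monotone convergence concludes.\<close>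

lemma nn_integral_powr_substitution:
  fixes f :: "real \<Rightarrow> real" and a :: real
  assumes [measurable]: "f \<in> borel_measurable borel" and a: "0 < a"
  shows "(\<integral>\<^sup>+x. ennreal (f (x powr a) * (a * x powr (a - 1))) * indicator {0<..} x \<partial>lborel) =
    (\<integral>\<^sup>+u. ennreal (f u) * indicator {0<..} u \<partial>lborel)"
proof -
  define K where "K N = {inverse (real (Suc N))..real (Suc N)}" for N
  define K' where "K' N = {inverse (real (Suc N)) powr a..real (Suc N) powr a}" for N
  have inc: "incseq K"
    by (auto simp: incseq_Suc_iff K_def field_simps)
  have K_ex: "\<exists>N. y \<in> K N" if y: "0 < y" for y
  proof -
    obtain N1 where N1: "inverse (real (Suc N1)) < y" using reals_Archimedean[OF y] by auto
    obtain N2 where N2: "y < real N2" using reals_Archimedean2 by auto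
    have "inverse (real (Suc (max N1 N2))) \<le> inverse (real (Suc N1))"
      by (rule le_imp_inverse_le) auto
    then have "inverse (real (Suc (max N1 N2))) \<le> y"
      using N1 by linarith
    moreover have "y \<le> real (Suc (max N1 N2))"
      using N2 by linarith
    ultimately show ?thesis
      by (intro exI[of _ "max N1 N2"]) (simp only: K_def atLeastAtMost_iff)
  qed
  have K_pos: "0 < y" if "y \<in> K N" for y N
    using that less_le_trans[of 0 "inverse (real (Suc N))" y] by (simp add: K_def)
  have K_Un: "(\<Union>N. K N) = {0<..}"
    using K_ex K_pos by auto
  have inc': "incseq K'"
  proof (rule incseq_SucI)
    fix N
    have "inverse (real (Suc (Suc N))) powr a \<le> inverse (real (Suc N)) powr a"
      using a by (intro powr_mono2 le_imp_inverse_le) auto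
    moreover have "real (Suc N) powr a \<le> real (Suc (Suc N)) powr a"
      using a by (intro powr_mono2) auto
    ultimately show "K' N \<le> K' (Suc N)"
      unfolding K'_def by (intro atLeastatMost_subset_iff[THEN iffD2]) blast
  qed
  have K'_Un: "(\<Union>N. K' N) = {0<..}"
  proof (intro set_eqI iffI)
    fix y :: real assume "y \<in> {0<..}"
    then have y: "0 < y" by simp
    then obtain N where N: "y powr (1 / a) \<in> K N"
      using K_ex[of "y powr (1 / a)"] by auto
    have "(y powr (1 / a)) powr a = y"
      using y a by (simp add: powr_powr)
    then have "y \<in> K' N"
      using N a powr_mono2[of a "inverse (real (Suc N))" "y powr (1 / a)"] powr_mono2[of a "y powr (1 / a)" "real (Suc N)"]
      by (simp add: K_def K'_def)
    then show "y \<in> (\<Union>N. K' N)" by auto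
  next
    fix y assume "y \<in> (\<Union>N. K' N)"
    then obtain N where "inverse (real (Suc N)) powr a \<le> y" by (auto simp: K'_def)
    moreover have "0 < inverse (real (Suc N)) powr a" by simp
    ultimately have "0 < y" by (rule less_le_trans[rotated])
    then show "y \<in> {0<..}" by simp
  qed
  have lim: "(\<lambda>N. \<integral>\<^sup>+x. ennreal (h x) * indicator (J N) x \<partial>lborel)
      \<longlonglongrightarrow> (\<integral>\<^sup>+x. ennreal (h x) * indicator {0<..} x \<partial>lborel)"
    if [measurable]: "h \<in> borel_measurable borel" "\<And>N. J N \<in> sets borel" and J: "incseq J" "(\<Union>N. J N) = {0<..}"
    for h :: "real \<Rightarrow> real" and J
  proof (rule nn_integral_LIMSEQ)
    show "incseq (\<lambda>N x. ennreal (h x) * indicator (J N) x)"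
      using J by (fastforce simp: incseq_def le_fun_def split: split_indicator)
    fix x
    show "(\<lambda>N. ennreal (h x) * indicator (J N) x) \<longlonglongrightarrow> ennreal (h x) * indicator {0<..} x"
      using LIMSEQ_indicator_incseq[OF J(1), of x, where 'a=ennreal] J(2) by (intro ennreal_tendsto_cmult) auto
  qed measurable
  have "(\<integral>\<^sup>+u. ennreal (f u) * indicator (K' N) u \<partial>lborel) =
      (\<integral>\<^sup>+x. ennreal (f (x powr a) * (a * x powr (a - 1))) * indicator (K N) x \<partial>lborel)" for N
  proof -
    have "(\<integral>\<^sup>+u. ennreal (f u * indicator (K' N) u) \<partial>lborel) =
        (\<integral>\<^sup>+x. ennreal (f (x powr a) * (a * x powr (a - 1)) * indicator (K N) x) \<partial>lborel)"
      unfolding K_def K'_def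
    proof (rule nn_integral_substitution)
      fix x assume "x \<in> {inverse (real (Suc N))..real (Suc N)}"
      then have x: "0 < x" using K_pos[of x N] by (simp add: K_def)
      then show "((\<lambda>x. x powr a) has_real_derivative a * x powr (a - 1)) (at x)"
        by (auto intro!: derivative_eq_intros simp: powr_diff)
      show "0 \<le> a * x powr (a - 1)" using a by simp
    next
      show "continuous_on {inverse (real (Suc N))..real (Suc N)} (\<lambda>x. a * x powr (a - 1))"
        using K_pos[of _ N] by (intro continuous_intros) (auto simp: K_def)
      show "inverse (real (Suc N)) \<le> real (Suc N)"
        by (simp add: field_simps)
    qed (simp add: set_borel_measurable_def)
    then show ?thesis
      by (simp add: ennreal_mult'' ennreal_indicator)
  qed
  then have "(\<lambda>N. \<integral>\<^sup>+u. ennreal (f u) * indicator (K' N) u \<partial>lborel)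
      \<longlonglongrightarrow> (\<integral>\<^sup>+x. ennreal (f (x powr a) * (a * x powr (a - 1))) * indicator {0<..} x \<partial>lborel)"
    using lim[of "\<lambda>x. f (x powr a) * (a * x powr (a - 1))" K] inc K_Un by (simp add: K_def)
  moreover have "(\<lambda>N. \<integral>\<^sup>+u. ennreal (f u) * indicator (K' N) u \<partial>lborel)
      \<longlonglongrightarrow> (\<integral>\<^sup>+u. ennreal (f u) * indicator {0<..} u \<partial>lborel)"
    using lim[of f K'] inc' K'_Un by (simp add: K'_def)
  ultimately show ?thesis
    by (rule LIMSEQ_unique)
qed

text \<open>Write 1 - exp(-l x) as the integral of x exp(-s x) over s in [0, l] and exchange the
  integrals. The inner one is \<alpha> Gamma(1 - \<alpha>) s^(\<alpha> - 1), which integrates to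
  Gamma(1 - \<alpha>) l^\<alpha>.\<close>

lemma nn_integral_one_minus_exp_stable:
  fixes \<alpha> l :: real
  assumes \<alpha>: "0 < \<alpha>" "\<alpha> < 1" and l: "0 < l"
  shows "(\<integral>\<^sup>+x. ennreal (\<alpha> * x powr (- \<alpha> - 1) * (1 - exp (- (l * x)))) * indicator {0<..} x \<partial>lborel) =
    ennreal (Gamma (1 - \<alpha>) * l powr \<alpha>)"
proof -
  have "(\<integral>\<^sup>+x. ennreal (\<alpha> * x powr (- \<alpha> - 1) * (1 - exp (- (l * x)))) * indicator {0<..} x \<partial>lborel) =
      (\<integral>\<^sup>+x. (\<integral>\<^sup>+s. ennreal (\<alpha> * x powr (- \<alpha>) * exp (- (s * x))) * indicator {0..l} s * indicator {0<..} x \<partial>lborel) \<partial>lborel)"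
  proof (rule nn_integral_cong)
    fix x :: real
    show "ennreal (\<alpha> * x powr (- \<alpha> - 1) * (1 - exp (- (l * x)))) * indicator {0<..} x =
        (\<integral>\<^sup>+s. ennreal (\<alpha> * x powr (- \<alpha>) * exp (- (s * x))) * indicator {0..l} s * indicator {0<..} x \<partial>lborel)"
    proof (cases "0 < x")
      case True
      have "(\<integral>\<^sup>+s. ennreal (\<alpha> * x powr (- \<alpha>) * exp (- (s * x))) * indicator {0..l} s \<partial>lborel) =
          ennreal (- (\<alpha> * x powr (- \<alpha> - 1) * exp (- (l * x))) - - (\<alpha> * x powr (- \<alpha> - 1) * exp (- (0 * x))))"
      proof (rule nn_integral_FTC_Icc)
        fix s :: real
        have "x powr (- \<alpha> - 1) * x = x powr (- \<alpha>)"
          using True by (simp add: powr_diff)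
        then show "((\<lambda>s. - (\<alpha> * x powr (- \<alpha> - 1) * exp (- (s * x)))) has_real_derivative
            \<alpha> * x powr (- \<alpha>) * exp (- (s * x))) (at s)"
          by (auto intro!: derivative_eq_intros simp: mult_ac)
      qed (use \<alpha> l in auto)
      then show ?thesis
        using True by (simp add: nn_integral_multc algebra_simps)
    qed simp
  qed
  also have "\<dots> = (\<integral>\<^sup>+s. (\<integral>\<^sup>+x. ennreal (\<alpha> * x powr (- \<alpha>) * exp (- (s * x))) * indicator {0..l} s * indicator {0<..} x \<partial>lborel) \<partial>lborel)"
    by (rule lborel_pair.Fubini') measurable
  also have "\<dots> = (\<integral>\<^sup>+s. ennreal (\<alpha> * Gamma (1 - \<alpha>)) * ennreal (indicator {0..l} s * s powr (\<alpha> - 1)) \<partial>lborel)"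
  proof (rule nn_integral_cong_AE)
    \<comment> \<open>At s = 0 the inner integral is infinite while \<open>powr\<close> gives 0, so
      this null point is excluded.\<close>
    have "AE s in lborel. s \<noteq> (0::real)" by (rule AE_lborel_singleton)
    then show "AE s in lborel. (\<integral>\<^sup>+x. ennreal (\<alpha> * x powr (- \<alpha>) * exp (- (s * x))) * indicator {0..l} s * indicator {0<..} x \<partial>lborel) =
        ennreal (\<alpha> * Gamma (1 - \<alpha>)) * ennreal (indicator {0..l} s * s powr (\<alpha> - 1))"
    proof eventually_elim
      case (elim s)
      show ?case
      proof (cases "s \<in> {0..l}")
        case True
        with elim have s: "0 < s" by simp
        have "(\<integral>\<^sup>+x. ennreal (\<alpha> * x powr (- \<alpha>) * exp (- (s * x))) * indicator {0..l} s * indicator {0<..} x \<partial>lborel) =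
            (\<integral>\<^sup>+x. ennreal \<alpha> * (ennreal (x powr ((1 - \<alpha>) - 1) * exp (- (s * x))) * indicator {0<..} x) \<partial>lborel)"
          using True \<alpha> by (intro nn_integral_cong) (simp add: ennreal_mult' mult_ac)
        also have "\<dots> = ennreal \<alpha> * ennreal (Gamma (1 - \<alpha>) * s powr (- (1 - \<alpha>)))"
          using nn_integral_Gamma_kernel[of "1 - \<alpha>" s] \<alpha> s by (subst nn_integral_cmult) auto
        finally show ?thesis
          using True \<alpha> by (simp add: ennreal_mult'[symmetric] mult_ac)
      qed simp
    qed
  qed
  also have "\<dots> = ennreal (\<alpha> * Gamma (1 - \<alpha>)) * ennreal (l powr (\<alpha> - 1 + 1) / (\<alpha> - 1 + 1))"
    using nn_integral_has_integral_lebesgue[OF _ has_integral_powr_from_0[of "\<alpha> - 1" l]] \<alpha> l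
    by (subst nn_integral_cmult) auto
  also have "\<dots> = ennreal (Gamma (1 - \<alpha>) * l powr \<alpha>)"
    using \<alpha> by (simp add: ennreal_mult'[symmetric])
  finally show ?thesis .
qed

lemma space_stable_intensity: "space (stable_intensity \<alpha>) = {0<..}"
  by (simp add: stable_intensity_def space_restrict_space)

lemma borel_measurable_stable_intensity [measurable_dest]:
  "f \<in> borel_measurable borel \<Longrightarrow> f \<in> borel_measurable (stable_intensity \<alpha>)"
  by (simp add: stable_intensity_def measurable_restrict_space1)

lemma sigma_finite_stable_intensity: "sigma_finite_measure (stable_intensity \<alpha>)"
proof -
  interpret sigma_finite_measure "restrict_space lborel {0::real<..}"
    by (intro sigma_finite_measure_restrict_space) (auto intro: lborel.sigma_finite_measure_axioms)
  show ?thesis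
    unfolding stable_intensity_def
    by (subst sigma_finite_iff_density_finite) (auto intro!: measurable_restrict_space1)
qed

lemma nn_integral_stable_intensity:
  assumes [measurable]: "f \<in> borel_measurable borel"
  shows "(\<integral>\<^sup>+x. f x \<partial>stable_intensity \<alpha>) = (\<integral>\<^sup>+x. ennreal (\<alpha> * x powr (- \<alpha> - 1)) * f x * indicator {0<..} x \<partial>lborel)"
  unfolding stable_intensity_def
  by (subst nn_integral_density) (auto intro!: measurable_restrict_space1 simp: nn_integral_restrict_space)

text \<open>Since m >= 1 > \<alpha>, the integrand x^(m - \<alpha> - 1) exp(-l x) is integrable at
  0. The exponent m will be a block size, and blocks are nonempty.\<close>

lemma nn_integral_stable_power:
  fixes \<alpha> l :: real
  assumes \<alpha>: "0 < \<alpha>" "\<alpha> < 1" and l: "0 < l" and m: "1 \<le> m"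
  shows "(\<integral>\<^sup>+x. ennreal (x ^ m * exp (- (l * x))) \<partial>stable_intensity \<alpha>) =
    ennreal (\<alpha> * Gamma (m - \<alpha>) * l powr (\<alpha> - m))"
proof -
  have "(\<integral>\<^sup>+x. ennreal (x ^ m * exp (- (l * x))) \<partial>stable_intensity \<alpha>) =
      (\<integral>\<^sup>+x. ennreal \<alpha> * (ennreal (x powr ((m - \<alpha>) - 1) * exp (- (l * x))) * indicator {0<..} x) \<partial>lborel)"
    using \<alpha> by (subst nn_integral_stable_intensity)
      (auto intro!: nn_integral_cong simp: indicator_def ennreal_mult'[symmetric] powr_realpow[symmetric] powr_add[symmetric] algebra_simps)
  also have "\<dots> = ennreal \<alpha> * ennreal (Gamma (m - \<alpha>) * l powr (- (m - \<alpha>)))"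
    using nn_integral_Gamma_kernel[of "m - \<alpha>" l] \<alpha> l m by (subst nn_integral_cmult) auto
  finally show ?thesis
    using \<alpha> by (simp add: ennreal_mult'[symmetric] mult_ac)
qed

lemma nn_integral_stable_one_minus_exp:
  fixes \<alpha> l :: real
  assumes \<alpha>: "0 < \<alpha>" "\<alpha> < 1" and l: "0 < l"
  shows "(\<integral>\<^sup>+x. 1 - exp_neg (ennreal (l * x)) \<partial>stable_intensity \<alpha>) = ennreal (Gamma (1 - \<alpha>) * l powr \<alpha>)"
proof -
  have "(\<integral>\<^sup>+x. 1 - exp_neg (ennreal (l * x)) \<partial>stable_intensity \<alpha>) =
      (\<integral>\<^sup>+x. ennreal (\<alpha> * x powr (- \<alpha> - 1) * (1 - exp (- (l * x)))) * indicator {0<..} x \<partial>lborel)"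
    using \<alpha> l by (subst nn_integral_stable_intensity)
      (auto intro!: nn_integral_cong simp: indicator_def one_minus_exp_neg_ennreal ennreal_mult'[symmetric])
  then show ?thesis
    using nn_integral_one_minus_exp_stable[OF assms] by simp
qed

text \<open>With u = x^\<alpha> the measure x^(k \<alpha> - 1) dx becomes u^(k-1) du / \<alpha>, and
  Gamma(k) / c^k remains. This evaluates the last integral over t.\<close>

lemma nn_integral_powr_exp_powr:
  fixes \<alpha> c :: real
  assumes \<alpha>: "0 < \<alpha>" and c: "0 < c" and k: "1 \<le> k"
  shows "(\<integral>\<^sup>+x. ennreal (x powr (k * \<alpha> - 1) * exp (- (c * x powr \<alpha>))) * indicator {0<..} x \<partial>lborel) =
    ennreal (fact (k - 1) / (\<alpha> * c ^ k))"
proof -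
  have "(\<integral>\<^sup>+x. ennreal (x powr (k * \<alpha> - 1) * exp (- (c * x powr \<alpha>))) * indicator {0<..} x \<partial>lborel) =
      (\<integral>\<^sup>+x. ennreal (1 / \<alpha>) * (ennreal (((x powr \<alpha>) powr (real k - 1) * exp (- (c * x powr \<alpha>))) * (\<alpha> * x powr (\<alpha> - 1))) * indicator {0<..} x) \<partial>lborel)"
    using \<alpha> by (intro nn_integral_cong)
      (auto simp: indicator_def ennreal_mult'[symmetric] powr_powr powr_add[symmetric] algebra_simps)
  also have "\<dots> = ennreal (1 / \<alpha>) * (\<integral>\<^sup>+u. ennreal (u powr (real k - 1) * exp (- (c * u))) * indicator {0<..} u \<partial>lborel)"
    using nn_integral_powr_substitution[of "\<lambda>u. u powr (real k - 1) * exp (- (c * u))" \<alpha>] \<alpha>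
    by (subst nn_integral_cmult) auto
  also have "\<dots> = ennreal (1 / \<alpha>) * ennreal (Gamma k * c powr (- k))"
    using nn_integral_Gamma_kernel[of k c] c k by simp
  also have "Gamma k * c powr (- k) = fact (k - 1) / c ^ k"
    using k c Gamma_fact[of "k - 1", where 'a=real] by (simp add: powr_minus powr_realpow divide_inverse)
  finally show ?thesis
    using \<alpha> c by (simp add: ennreal_mult'[symmetric])
qed

section \<open>Exponential races\<close>

context prob_space
begin

text \<open>The joint law is the product of the marginals, since both agree on rectangles; Tonelli
  then freezes the first element. This replaces conditional probabilities throughout.\<close>

lemma emeasure_indep_elements:
  assumes ind: "indep_elements M N X N' X'" and [measurable]: "E \<in> sets (N \<Otimes>\<^sub>M N')"
  shows "emeasure M {\<omega> \<in> space M. (X \<omega>, X' \<omega>) \<in> E} =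
    (\<integral>\<^sup>+\<omega>. emeasure M {\<omega>' \<in> space M. (X \<omega>, X' \<omega>') \<in> E} \<partial>M)"
proof -
  have X [measurable]: "X \<in> measurable M N" and X' [measurable]: "X' \<in> measurable M N'"
    and iset: "indep_set {X -` A \<inter> space M | A. A \<in> sets N} {X' -` B \<inter> space M | B. B \<in> sets N'}"
    using ind by (auto simp: indep_elements_def)
  interpret D: prob_space "distr M N X" by (rule prob_space_distr) fact
  interpret D': prob_space "distr M N' X'" by (rule prob_space_distr) fact
  have eq: "distr M N X \<Otimes>\<^sub>M distr M N' X' = distr M (N \<Otimes>\<^sub>M N') (\<lambda>\<omega>. (X \<omega>, X' \<omega>))"
  proof (rule pair_measure_eqI)
    fix A B assume "A \<in> sets (distr M N X)" "B \<in> sets (distr M N' X')"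
    then have AB [measurable]: "A \<in> sets N" "B \<in> sets N'" by auto
    have "prob ((X -` A \<inter> space M) \<inter> (X' -` B \<inter> space M)) = prob (X -` A \<inter> space M) * prob (X' -` B \<inter> space M)"
      by (rule indep_setD[OF iset]) (use AB in auto)
    moreover have "(X -` A \<inter> space M) \<inter> (X' -` B \<inter> space M) = (\<lambda>\<omega>. (X \<omega>, X' \<omega>)) -` (A \<times> B) \<inter> space M"
      by auto
    ultimately show "emeasure (distr M N X) A * emeasure (distr M N' X') B =
        emeasure (distr M (N \<Otimes>\<^sub>M N') (\<lambda>\<omega>. (X \<omega>, X' \<omega>))) (A \<times> B)"
      by (simp add: emeasure_distr emeasure_eq_measure ennreal_mult')
  qed (auto intro: D.sigma_finite_measure_axioms D'.sigma_finite_measure_axioms)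
  have "emeasure M {\<omega> \<in> space M. (X \<omega>, X' \<omega>) \<in> E} = emeasure (distr M N X \<Otimes>\<^sub>M distr M N' X') E"
    unfolding eq by (subst emeasure_distr) (auto intro!: arg_cong[where f="emeasure M"])
  also have "\<dots> = (\<integral>\<^sup>+x. emeasure (distr M N' X') (Pair x -` E) \<partial>distr M N X)"
    by (intro D'.emeasure_pair_measure_alt) (simp cong: sets_pair_measure_cong)
  also have "\<dots> = (\<integral>\<^sup>+\<omega>. emeasure (distr M N' X') (Pair (X \<omega>) -` E) \<partial>M)"
    by (intro nn_integral_distr X D'.measurable_emeasure_Pair) (simp cong: sets_pair_measure_cong)
  also have "\<dots> = (\<integral>\<^sup>+\<omega>. emeasure M {\<omega>' \<in> space M. (X \<omega>, X' \<omega>') \<in> E} \<partial>M)"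
    by (intro nn_integral_cong, subst emeasure_distr) (auto intro!: arg_cong[where f="emeasure M"] sets_Pair1)
  finally show ?thesis .
qed

lemma indep_var_imp_indep_elements:
  assumes "indep_var N X N' X'"
  shows "indep_elements M N X N' X'"
proof -
  have "indep_set {X -` A \<inter> space M | A. A \<in> sets N} {X' -` B \<inter> space M | B. B \<in> sets N'}"
    using assms unfolding indep_var_eq indep_set_def
    by (elim conjE indep_sets_mono_sets) (auto split: bool.split)
  then show ?thesis
    using assms unfolding indep_elements_def indep_var_eq by simp
qed

text \<open>The distribution function determines the strict inequality by approaching
  \<open>b\<close> from below; its continuity rules out an atom.\<close>

lemma frechet1_less:
  assumes Y: "frechet1 M \<sigma> Y" and b: "0 < b"
  shows "prob {\<omega> \<in> space M. Y \<omega> < b} = exp (- \<sigma> / b)"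
proof -
  have [measurable]: "Y \<in> borel_measurable M" using Y by (simp add: frechet1_def)
  \<comment> \<open>The shift by two makes even the first term positive (it is b / 2), where the
    Frechet formula applies.\<close>
  define c where "c N = b - b * inverse (real (Suc (Suc N)))" for N
  have c_lim: "c \<longlonglongrightarrow> b"
  proof -
    have "(\<lambda>N. b - b * inverse (real (Suc (Suc N)))) \<longlonglongrightarrow> b - b * 0"
      by (intro tendsto_diff tendsto_mult tendsto_const LIMSEQ_Suc[OF LIMSEQ_inverse_real_of_nat])
    then show ?thesis by (simp add: c_def[abs_def])
  qed
  have c_pos: "0 < c N" for N using b by (simp add: c_def field_simps add_pos_nonneg)
  have c_less: "c N < b" for N using b by (simp add: c_def)
  have "incseq c"
    using b by (auto simp: incseq_Suc_iff c_def field_simps)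
  then have inc: "incseq (\<lambda>N. {\<omega> \<in> space M. Y \<omega> \<le> c N})"
    by (fastforce simp: incseq_def intro: order_trans)
  have "(\<lambda>N. prob {\<omega> \<in> space M. Y \<omega> \<le> c N}) \<longlonglongrightarrow> prob (\<Union>N. {\<omega> \<in> space M. Y \<omega> \<le> c N})"
    by (intro finite_Lim_measure_incseq inc) auto
  also have "(\<Union>N. {\<omega> \<in> space M. Y \<omega> \<le> c N}) = {\<omega> \<in> space M. Y \<omega> < b}"
  proof (intro set_eqI iffI)
    fix \<omega> assume \<omega>: "\<omega> \<in> {\<omega> \<in> space M. Y \<omega> < b}"
    then have "\<forall>\<^sub>F N in sequentially. Y \<omega> < c N"
      using order_tendstoD(1)[OF c_lim] by auto
    then obtain N where "Y \<omega> < c N"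
      by (auto simp: eventually_sequentially)
    then show "\<omega> \<in> (\<Union>N. {\<omega> \<in> space M. Y \<omega> \<le> c N})" using \<omega> by (auto intro: less_imp_le)
  qed (use c_less in \<open>auto intro: le_less_trans\<close>)
  also have "(\<lambda>N. prob {\<omega> \<in> space M. Y \<omega> \<le> c N}) = (\<lambda>N. exp (- \<sigma> / c N))"
    using Y c_pos by (simp add: frechet1_def)
  finally have "(\<lambda>N. exp (- \<sigma> / c N)) \<longlonglongrightarrow> prob {\<omega> \<in> space M. Y \<omega> < b}" .
  moreover have "(\<lambda>N. exp (- \<sigma> / c N)) \<longlonglongrightarrow> exp (- \<sigma> / b)"
    by (intro tendsto_intros c_lim) (use b in simp)
  ultimately show ?thesis by (rule LIMSEQ_unique)
qed

text \<open>The distribution function is prescribed at positive arguments only; letting them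
  decrease to 0 shows that no mass lies at or below 0.\<close>

lemma frechet1_AE_pos:
  assumes Y: "frechet1 M \<sigma> Y" and \<sigma>: "0 < \<sigma>"
  shows "AE \<omega> in M. 0 < Y \<omega>"
proof -
  have [measurable]: "Y \<in> borel_measurable M" using Y by (simp add: frechet1_def)
  have "prob {\<omega> \<in> space M. Y \<omega> \<le> 0} \<le> 0"
  proof (rule LIMSEQ_le_const)
    have "(\<lambda>N. exp (- \<sigma>) ^ Suc N) \<longlonglongrightarrow> 0"
      using \<sigma> by (intro LIMSEQ_Suc LIMSEQ_realpow_zero) auto
    then show "(\<lambda>N. exp (- \<sigma> / (1 / real (Suc N)))) \<longlonglongrightarrow> 0"
      by (simp add: exp_of_nat_mult[symmetric] mult.commute del: of_nat_Suc power_Suc)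
    have "prob {\<omega> \<in> space M. Y \<omega> \<le> 0} \<le> exp (- \<sigma> / (1 / real (Suc N)))" for N
    proof -
      have "prob {\<omega> \<in> space M. Y \<omega> \<le> 0} \<le> prob {\<omega> \<in> space M. Y \<omega> \<le> 1 / real (Suc N)}"
        by (intro finite_measure_mono) (auto intro: order_trans)
      also have "\<dots> = exp (- \<sigma> / (1 / real (Suc N)))"
        using Y unfolding frechet1_def by (metis of_nat_0_less_iff zero_less_Suc zero_less_divide_1_iff)
      finally show ?thesis .
    qed
    then show "\<exists>N. \<forall>n\<ge>N. prob {\<omega> \<in> space M. Y \<omega> \<le> 0} \<le> exp (- \<sigma> / (1 / real (Suc n)))" by auto
  qed
  then have "prob {\<omega> \<in> space M. Y \<omega> \<le> 0} = 0"
    by (simp add: measure_le_0_iff)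
  then show ?thesis
    by (subst (asm) prob_eq_0) (auto simp: not_le elim: AE_mp)
qed

lemma frechet1_inverse_exponential:
  assumes Y: "frechet1 M \<sigma> Y" and \<sigma>: "0 < \<sigma>"
  shows "distributed M lborel (\<lambda>\<omega>. inverse (Y \<omega>)) (exponential_density \<sigma>)"
proof (rule exponential_distributedI)
  show [measurable]: "(\<lambda>\<omega>. inverse (Y \<omega>)) \<in> borel_measurable M"
    using Y by (auto simp: frechet1_def)
  have [measurable]: "Y \<in> borel_measurable M" using Y by (simp add: frechet1_def)
  fix a :: real assume a: "0 \<le> a"
  have "prob {\<omega> \<in> space M. inverse (Y \<omega>) \<le> a} = 1 - exp (- a * \<sigma>)"
  proof (cases "a = 0")
    case True
    have "AE \<omega> in M. \<not> inverse (Y \<omega>) \<le> a"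
      using frechet1_AE_pos[OF assms] by eventually_elim (simp add: True)
    then show ?thesis
      using True by (subst prob_eq_0[THEN iffD2]) auto
  next
    case False
    with a have a: "0 < a" by simp
    have "prob {\<omega> \<in> space M. inverse (Y \<omega>) \<le> a} = prob {\<omega> \<in> space M. \<not> Y \<omega> < 1 / a}"
    proof (rule finite_measure_eq_AE)
      show "AE \<omega> in M. \<omega> \<in> {\<omega> \<in> space M. inverse (Y \<omega>) \<le> a} \<longleftrightarrow> \<omega> \<in> {\<omega> \<in> space M. \<not> Y \<omega> < 1 / a}"
        using frechet1_AE_pos[OF assms] by eventually_elim (use a in \<open>auto simp: field_simps\<close>)
    qed auto
    also have "\<dots> = 1 - exp (- \<sigma> / (1 / a))"
      using prob_neg[of "\<lambda>\<omega>. Y \<omega> < 1 / a"] frechet1_less[OF Y, of "1 / a"] a by simp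
    finally show ?thesis by (simp add: mult.commute)
  qed
  then show "emeasure M {\<omega> \<in> space M. inverse (Y \<omega>) \<le> a} = 1 - ennreal (exp (- a * \<sigma>))"
    by (simp add: emeasure_eq_measure ennreal_minus flip: ennreal_1)
qed (rule \<sigma>)

text \<open>Multiplying the density of rate \<sigma> by exp(-c u) gives a multiple of the density of
  rate \<sigma> + c, whose total mass is 1.\<close>

lemma exponential_laplace:
  assumes U: "distributed M lborel U (exponential_density \<sigma>)" and \<sigma>: "0 < \<sigma>" and c: "0 \<le> c"
  shows "(\<integral>\<^sup>+\<omega>. ennreal (exp (- c * U \<omega>)) \<partial>M) = ennreal (\<sigma> / (\<sigma> + c))"
proof -
  interpret E: prob_space "density lborel (exponential_density (\<sigma> + c))"
    using \<sigma> c by (intro prob_space_exponential_density) simp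
  have one: "(\<integral>\<^sup>+u. ennreal (exponential_density (\<sigma> + c) u) \<partial>lborel) = 1"
    using E.emeasure_space_1 by (simp add: emeasure_density)
  have "(\<integral>\<^sup>+\<omega>. ennreal (exp (- c * U \<omega>)) \<partial>M) =
      (\<integral>\<^sup>+u. ennreal (exponential_density \<sigma> u) * ennreal (exp (- c * u)) \<partial>lborel)"
    by (rule distributed_nn_integral[OF U, symmetric]) measurable
  also have "\<dots> = (\<integral>\<^sup>+u. ennreal (\<sigma> / (\<sigma> + c)) * ennreal (exponential_density (\<sigma> + c) u) \<partial>lborel)"
  proof (rule nn_integral_cong)
    fix u :: real
    have e: "exp (- (\<sigma> + c) * u) = exp (- \<sigma> * u) * exp (- c * u)"
      by (simp add: exp_add[symmetric] algebra_simps)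
    have "\<sigma> + c \<noteq> 0"
      using \<sigma> c by simp
    then have "exponential_density \<sigma> u * exp (- c * u) = \<sigma> / (\<sigma> + c) * exponential_density (\<sigma> + c) u"
      unfolding erlang_density_def e by simp
    then show "ennreal (exponential_density \<sigma> u) * ennreal (exp (- c * u)) =
        ennreal (\<sigma> / (\<sigma> + c)) * ennreal (exponential_density (\<sigma> + c) u)"
      using \<sigma> c by (simp add: ennreal_mult'[symmetric] ennreal_mult''[symmetric])
  qed
  also have "\<dots> = ennreal (\<sigma> / (\<sigma> + c))"
    by (subst nn_integral_cmult) (auto simp: one)
  finally show ?thesis .
qed

text \<open>The clocks U_j / x_j have rates \<sigma> x_j, and the event says that clock l rings
  first. Given U_l, each rival is later with probability exp(-\<sigma> x_j U_l / x_l); the product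
  over \<open>J\<close> is exp(-c U_l), whose mean is a Laplace transform.\<close>

lemma exponential_race_finite:
  fixes U :: "nat \<Rightarrow> 'a \<Rightarrow> real"
  assumes ind: "indep_vars (\<lambda>_. borel) U UNIV"
    and U: "\<And>j. distributed M lborel (U j) (exponential_density \<sigma>)" and \<sigma>: "0 < \<sigma>"
    and x: "\<And>j. 0 < x j" and J: "finite J" "l \<notin> J"
  shows "prob {\<omega> \<in> space M. \<forall>j\<in>J. x j * U l \<omega> < x l * U j \<omega>} = x l / (x l + sum x J)"
proof -
  let ?A = "\<lambda>\<omega>. \<lambda>i\<in>{l}. U i \<omega>" and ?B = "\<lambda>\<omega>. \<lambda>i\<in>J. U i \<omega>"
  have [measurable]: "U j \<in> borel_measurable M" for j
    using U[of j] by (auto simp: distributed_def)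
  have "indep_var (PiM {l} (\<lambda>_. borel)) ?A (PiM J (\<lambda>_. borel)) ?B"
    by (rule indep_var_restrict[OF ind]) (use J in auto)
  then have el: "indep_elements M (PiM {l} (\<lambda>_. borel)) ?A (PiM J (\<lambda>_. borel)) ?B"
    by (rule indep_var_imp_indep_elements)
  define E where "E = {p \<in> space (PiM {l} (\<lambda>_. borel :: real measure) \<Otimes>\<^sub>M PiM J (\<lambda>_. borel)).
      \<forall>j\<in>J. x j * fst p l < x l * snd p j}"
  have E: "E \<in> sets (PiM {l} (\<lambda>_. borel) \<Otimes>\<^sub>M PiM J (\<lambda>_. borel))"
    unfolding E_def using J by measurable
  have in_E: "(?A \<omega>, ?B \<omega>') \<in> E \<longleftrightarrow> (\<forall>j\<in>J. x j * U l \<omega> < x l * U j \<omega>')" for \<omega> \<omega>'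
    using J by (auto simp: E_def space_pair_measure space_PiM)
  define c where "c = \<sigma> * (sum x J / x l)"
  have c: "0 \<le> c" unfolding c_def using x \<sigma> by (simp add: sum_nonneg less_imp_le)
  have AE_pos: "AE \<omega> in M. 0 \<le> U l \<omega>"
  proof -
    have "prob {\<omega> \<in> space M. 0 < U l \<omega>} = 1"
      using exponential_distributedD_gt[OF U, of 0 l] \<sigma> by simp
    then show ?thesis
      by (subst (asm) prob_Collect_eq_1) (auto elim: AE_mp)
  qed
  have "emeasure M {\<omega> \<in> space M. \<forall>j\<in>J. x j * U l \<omega> < x l * U j \<omega>} =
      (\<integral>\<^sup>+\<omega>. emeasure M {\<omega>' \<in> space M. \<forall>j\<in>J. x j * U l \<omega> < x l * U j \<omega>'} \<partial>M)"
    using emeasure_indep_elements[OF el E] unfolding in_E .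
  also have "\<dots> = (\<integral>\<^sup>+\<omega>. ennreal (exp (- c * U l \<omega>)) \<partial>M)"
  proof (rule nn_integral_cong_AE, use AE_pos in eventually_elim)
    case (elim \<omega>)
    show ?case
    proof (cases "J = {}")
      case True
      then show ?thesis by (simp add: c_def emeasure_space_1)
    next
      case False
      have "{\<omega>' \<in> space M. \<forall>j\<in>J. x j * U l \<omega> < x l * U j \<omega>'} =
          (\<Inter>j\<in>J. U j -` {x j * U l \<omega> / x l<..} \<inter> space M)"
        using False x[of l] by (auto simp: field_simps)
      then have "prob {\<omega>' \<in> space M. \<forall>j\<in>J. x j * U l \<omega> < x l * U j \<omega>'} =
          (\<Prod>j\<in>J. prob (U j -` {x j * U l \<omega> / x l<..} \<inter> space M))"
        using indep_varsD[OF ind False J(1)] by simp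
      also have "\<dots> = (\<Prod>j\<in>J. exp (- (x j * U l \<omega> / x l) * \<sigma>))"
      proof (intro prod.cong refl)
        fix j
        have "0 \<le> x j * U l \<omega> / x l" using elim x by (simp add: less_imp_le)
        then show "prob (U j -` {x j * U l \<omega> / x l<..} \<inter> space M) = exp (- (x j * U l \<omega> / x l) * \<sigma>)"
          using exponential_distributedD_gt[OF U, of "x j * U l \<omega> / x l" j] \<sigma>
          by (simp add: vimage_def Int_def conj_commute)
      qed
      also have "\<dots> = exp (- c * U l \<omega>)"
        using J by (simp add: exp_sum[symmetric] c_def sum_distrib_right sum_distrib_left sum_divide_distrib sum_negf mult_ac)
      finally show ?thesis by (simp add: emeasure_eq_measure)
    qed
  qed
  also have "\<dots> = ennreal (\<sigma> / (\<sigma> + c))"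
    using U \<sigma> c by (rule exponential_laplace)
  also have "\<sigma> / (\<sigma> + c) = x l / (x l + sum x J)"
  proof -
    have "\<sigma> + c = \<sigma> * ((x l + sum x J) / x l)"
      using x[of l] by (simp add: c_def field_simps)
    then show ?thesis using \<sigma> by simp
  qed
  finally show ?thesis
    using x by (simp add: emeasure_eq_measure sum_nonneg less_imp_le)
qed

text \<open>The event for all rivals is the decreasing limit of those for the rivals below N. Once N
  > l, the denominators are exactly the partial sums of \<open>x\<close>.\<close>

lemma exponential_race:
  fixes U :: "nat \<Rightarrow> 'a \<Rightarrow> real"
  assumes ind: "indep_vars (\<lambda>_. borel) U UNIV"
    and U: "\<And>j. distributed M lborel (U j) (exponential_density \<sigma>)" and \<sigma>: "0 < \<sigma>"
    and x: "\<And>j. 0 < x j" "summable x"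
  shows "prob {\<omega> \<in> space M. \<forall>j. j \<noteq> l \<longrightarrow> x j * U l \<omega> < x l * U j \<omega>} = x l / suminf x"
proof -
  have [measurable]: "U j \<in> borel_measurable M" for j
    using U[of j] by (auto simp: distributed_def)
  let ?F = "\<lambda>N. {\<omega> \<in> space M. \<forall>j\<in>{..<N} - {l}. x j * U l \<omega> < x l * U j \<omega>}"
  have "(\<lambda>N. prob (?F N)) \<longlonglongrightarrow> prob (\<Inter>N. ?F N)"
    by (intro finite_Lim_measure_decseq) (auto simp: decseq_def)
  also have "(\<Inter>N. ?F N) = {\<omega> \<in> space M. \<forall>j. j \<noteq> l \<longrightarrow> x j * U l \<omega> < x l * U j \<omega>}"
    by auto
  finally have lim: "(\<lambda>N. prob (?F N)) \<longlonglongrightarrow> prob {\<omega> \<in> space M. \<forall>j. j \<noteq> l \<longrightarrow> x j * U l \<omega> < x l * U j \<omega>}" .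
  have S: "0 < suminf x"
    using x by (intro suminf_pos) auto
  have "(\<lambda>N. x l / sum x {..<N}) \<longlonglongrightarrow> x l / suminf x"
    using S by (intro tendsto_intros summable_LIMSEQ x(2)) auto
  moreover have "\<forall>\<^sub>F N in sequentially. x l / sum x {..<N} = prob (?F N)"
    using eventually_gt_at_top[of l]
  proof eventually_elim
    case (elim N)
    then have "sum x {..<N} = x l + sum x ({..<N} - {l})"
      by (intro sum.remove) auto
    then show ?case
      using exponential_race_finite[where x=x and l=l and J="{..<N} - {l}", OF ind U \<sigma> x(1)] by simp
  qed
  ultimately have "(\<lambda>N. prob (?F N)) \<longlonglongrightarrow> x l / suminf x"
    by (rule Lim_transform_eventually)
  with lim show ?thesis
    by (rule LIMSEQ_unique)
qed

text \<open>For positive variables, cross-multiplication turns the largest x_j V_j into the smallest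
  (1 / V_j) / x_j. The scale \<sigma> disappears because only comparisons matter.\<close>

lemma frechet_race:
  fixes V :: "nat \<Rightarrow> 'a \<Rightarrow> real"
  assumes ind: "indep_vars (\<lambda>_. borel) V UNIV"
    and V: "\<And>j. frechet1 M \<sigma> (V j)" and \<sigma>: "0 < \<sigma>"
    and x: "\<And>j. 0 < x j" "summable x"
  shows "prob {\<omega> \<in> space M. \<forall>j. j \<noteq> l \<longrightarrow> x j * V j \<omega> < x l * V l \<omega>} = x l / suminf x"
proof -
  have [measurable]: "V j \<in> borel_measurable M" for j
    using V[of j] by (simp add: frechet1_def)
  have pos: "AE \<omega> in M. \<forall>j. 0 < V j \<omega>"
    using frechet1_AE_pos[OF V \<sigma>] by (simp add: AE_all_countable)
  have "prob {\<omega> \<in> space M. \<forall>j. j \<noteq> l \<longrightarrow> x j * V j \<omega> < x l * V l \<omega>} =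
      prob {\<omega> \<in> space M. \<forall>j. j \<noteq> l \<longrightarrow> x j * inverse (V l \<omega>) < x l * inverse (V j \<omega>)}"
  proof (rule finite_measure_eq_AE)
    show "AE \<omega> in M. \<omega> \<in> {\<omega> \<in> space M. \<forall>j. j \<noteq> l \<longrightarrow> x j * V j \<omega> < x l * V l \<omega>} \<longleftrightarrow>
        \<omega> \<in> {\<omega> \<in> space M. \<forall>j. j \<noteq> l \<longrightarrow> x j * inverse (V l \<omega>) < x l * inverse (V j \<omega>)}"
      using pos
    proof eventually_elim
      case (elim \<omega>)
      have "x j * V j \<omega> < x l * V l \<omega> \<longleftrightarrow> x j * inverse (V l \<omega>) < x l * inverse (V j \<omega>)" for j
      proof -
        have "0 < V j \<omega>" "0 < V l \<omega>" using elim by auto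
        then show ?thesis by (simp add: field_simps)
      qed
      then show ?case by simp
    qed
  qed measurable
  also have "\<dots> = x l / suminf x"
    by (intro exponential_race[where \<sigma>=\<sigma>] indep_vars_compose2[OF ind] frechet1_inverse_exponential V \<sigma> x) auto
  finally show ?thesis .
qed

end

section \<open>Hitting partitions and independence of columns\<close>

text \<open>The classes are the fibres of \<open>h\<close>, and \<open>ls\<close> records the value
  of \<open>h\<close> on each block; its distinctness says that different blocks are not merged. An
  event about partitions thus becomes a union over injective lists.\<close>

lemma quotient_kernel_eq_blocks_iff:
  assumes bs: "distinct bs" "partition_on A (set bs)"
  shows "A // {(i, j). i \<in> A \<and> j \<in> A \<and> h i = h j} = set bs \<longleftrightarrow>
    (\<exists>ls. length ls = length bs \<and> distinct ls \<and> (\<forall>i<length bs. \<forall>m\<in>bs ! i. h m = ls ! i))"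
    (is "A // ?R = _ \<longleftrightarrow> ?Q")
proof
  have ne: "bs ! i \<noteq> {}" and sub: "bs ! i \<subseteq> A" if "i < length bs" for i
    using bs(2) nth_mem[OF that] partition_onD1[OF bs(2)] partition_onD3[OF bs(2)] by auto
  assume q: "A // ?R = set bs"
  have equal: "h a = h b" if "i < length bs" "a \<in> bs ! i" "b \<in> bs ! i" for i a b
  proof -
    have "bs ! i \<in> A // ?R" using q that by simp
    then show ?thesis using that by (auto simp: quotient_def)
  qed
  have separate: "i = j" if ij: "i < length bs" "j < length bs" and ab: "a \<in> bs ! i" "b \<in> bs ! j" "h a = h b" for i j a b
  proof -
    have "bs ! i \<in> A // ?R" "bs ! j \<in> A // ?R" using q ij by simp_all
    then have "bs ! i = bs ! j" using ab by (auto simp: quotient_def)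
    then show ?thesis using bs(1) ij by (simp add: nth_eq_iff_index_eq)
  qed
  define ls where "ls = map (\<lambda>B. h (SOME m. m \<in> B)) bs"
  have ls: "h m = ls ! i" if "i < length bs" "m \<in> bs ! i" for i m
  proof -
    have "(SOME m. m \<in> bs ! i) \<in> bs ! i" using that(2) by (rule someI)
    then show ?thesis using equal[OF that] that(1) by (simp add: ls_def)
  qed
  moreover have "distinct ls"
  proof (subst distinct_conv_nth, intro allI impI)
    fix i j assume ij: "i < length ls" "j < length ls" "i \<noteq> j"
    then have len: "i < length bs" "j < length bs" by (simp_all add: ls_def)
    obtain a b where "a \<in> bs ! i" "b \<in> bs ! j" using ne[OF len(1)] ne[OF len(2)] by blast
    then show "ls ! i \<noteq> ls ! j"
      using separate[OF len] ls[OF len(1)] ls[OF len(2)] ij(3) by metis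
  qed
  ultimately show ?Q
    by (intro exI[of _ ls]) (auto simp: ls_def)
next
  assume ?Q
  then obtain ls where ls: "length ls = length bs" "distinct ls" "\<And>i m. i < length bs \<Longrightarrow> m \<in> bs ! i \<Longrightarrow> h m = ls ! i"
    by blast
  have A: "A = \<Union>(set bs)" using bs(2) by (rule partition_onD1)
  have cls: "?R `` {m} = bs ! i" if i: "i < length bs" and m: "m \<in> bs ! i" for i m
  proof (intro set_eqI iffI)
    fix m' assume "m' \<in> ?R `` {m}"
    then have m': "m' \<in> A" "h m' = h m" by auto
    then obtain j where j: "j < length bs" "m' \<in> bs ! j"
      unfolding A by (auto simp: in_set_conv_nth)
    then have "ls ! j = ls ! i" using ls(3) i m m' by metis
    then show "m' \<in> bs ! i" using j i ls by (simp add: nth_eq_iff_index_eq)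
  next
    fix m' assume "m' \<in> bs ! i"
    then show "m' \<in> ?R `` {m}" using ls(3)[OF i] m i unfolding A by auto
  qed
  show "A // ?R = set bs"
  proof (intro set_eqI iffI)
    fix B assume "B \<in> A // ?R"
    then obtain m where m: "m \<in> A" "B = ?R `` {m}" by (auto simp: quotient_def)
    then obtain i where i: "i < length bs" "m \<in> bs ! i"
      unfolding A by (auto simp: in_set_conv_nth)
    show "B \<in> set bs" unfolding m(2) cls[OF i] using i(1) by (rule nth_mem)
  next
    fix B assume "B \<in> set bs"
    then obtain i where i: "i < length bs" "B = bs ! i" by (auto simp: in_set_conv_nth)
    then obtain m where m: "m \<in> bs ! i"
      using partition_onD3[OF bs(2)] nth_mem[OF i(1)] by (metis ex_in_conv)
    then have "m \<in> A" unfolding A using i by auto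
    then show "B \<in> A // ?R" using cls[OF i(1) m] i by (auto simp: quotient_def)
  qed
qed

lemma prod_blocks:
  fixes u :: "nat \<Rightarrow> 'b::comm_monoid_mult"
  assumes bs: "distinct bs" "partition_on {1..n} (set bs)"
  shows "(\<Prod>i<length bs. \<Prod>m\<in>bs ! i. u m) = (\<Prod>m\<in>{1..n}. u m)"
proof -
  have U: "{1..n} = (\<Union>i<length bs. bs ! i)"
    using partition_onD1[OF bs(2)] by (auto simp: set_conv_nth)
  show ?thesis
    unfolding U
  proof (rule prod.UNION_disjoint[symmetric])
    show "\<forall>i\<in>{..<length bs}. finite (bs ! i)"
      using U by (metis UN_upper finite_atLeastAtMost finite_subset)
    show "\<forall>i\<in>{..<length bs}. \<forall>j\<in>{..<length bs}. i \<noteq> j \<longrightarrow> bs ! i \<inter> bs ! j = {}"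
      using partition_onD2[OF bs(2)] bs(1) by (auto simp: disjoint_def nth_eq_iff_index_eq)
  qed simp
qed

text \<open>A strict maximiser is the only one, so the \<open>LEAST\<close> convention has no effect
  in this case.\<close>

lemma hit_index_eqI:
  assumes "\<And>j. j \<noteq> l \<Longrightarrow> \<xi> j \<omega> * Y j k \<omega> < \<xi> l \<omega> * Y l k \<omega>"
  shows "hit_index \<xi> Y \<omega> k = l"
  unfolding hit_index_def
proof (rule Least_equality)
  show "is_arg_max (\<lambda>l. \<xi> l \<omega> * Y l k \<omega>) (\<lambda>_. True) l"
    unfolding is_arg_max_def using assms by (metis less_asym)
  fix l' assume "is_arg_max (\<lambda>l. \<xi> l \<omega> * Y l k \<omega>) (\<lambda>_. True) l'"
  then show "l \<le> l'"
    unfolding is_arg_max_def using assms by (metis order_refl)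
qed

lemma measurable_hit_index [measurable]:
  fixes Y :: "nat \<Rightarrow> nat \<Rightarrow> 'a \<Rightarrow> real"
  assumes [measurable]: "\<And>l. \<xi> l \<in> borel_measurable M" "\<And>l. Y l k \<in> borel_measurable M"
  shows "(\<lambda>\<omega>. hit_index \<xi> Y \<omega> k) \<in> measurable M (count_space UNIV)"
  unfolding hit_index_def is_arg_max_def by measurable

lemma hitting_partition_eq_iff:
  assumes "distinct bs" "partition_on {1..n} (set bs)"
  shows "hitting_partition n \<xi> Y \<omega> = set bs \<longleftrightarrow>
    (\<exists>ls\<in>inj_lists (length bs). \<forall>i<length bs. \<forall>m\<in>bs ! i. hit_index \<xi> Y \<omega> m = ls ! i)"
  unfolding hitting_partition_def quotient_kernel_eq_blocks_iff[OF assms] inj_lists_def by auto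

lemma pred_hitting_partition:
  fixes Y :: "nat \<Rightarrow> nat \<Rightarrow> 'a \<Rightarrow> real"
  assumes bs: "distinct bs" "partition_on {1..n} (set bs)"
    and [measurable]: "\<And>l. \<xi> l \<in> borel_measurable M" "\<And>l k. k \<in> {1..n} \<Longrightarrow> Y l k \<in> borel_measurable M"
  shows "Measurable.pred M (\<lambda>\<omega>. hitting_partition n \<xi> Y \<omega> = set bs)"
proof -
  have sub: "bs ! i \<subseteq> {1..n}" if "i < length bs" for i
    using partition_onD1[OF bs(2)] nth_mem[OF that] by blast
  have "Measurable.pred M (\<lambda>\<omega>. hit_index \<xi> Y \<omega> m = c)" if "m \<in> {1..n}" for m c
    using measurable_hit_index[of \<xi> M Y m] assms(3,4) that by measurable
  then have [measurable]: "Measurable.pred M (\<lambda>\<omega>. \<forall>m\<in>bs ! i. hit_index \<xi> Y \<omega> m = c)" if "i < length bs" for i c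
    using sub[OF that] by (intro pred_intros_countable_bounded) (auto intro: countable_subset)
  show ?thesis
    unfolding hitting_partition_eq_iff[OF bs]
    by (intro pred_intros_countable_bounded) (auto simp: inj_lists_def)
qed

lemma partition_on_hitting_partition: "partition_on {1..n} (hitting_partition n \<xi> Y \<omega>)"
  unfolding hitting_partition_def
  by (intro partition_on_quotient equivI) (auto simp: refl_on_def sym_def trans_def)

text \<open>There are finitely many partitions of {1..n}, so it suffices to treat one at a time,
  with its blocks put into a list.\<close>

lemma measurable_hitting_partition:
  fixes Y :: "nat \<Rightarrow> nat \<Rightarrow> 'a \<Rightarrow> real"
  assumes "\<And>l. \<xi> l \<in> borel_measurable M" "\<And>l k. k \<in> {1..n} \<Longrightarrow> Y l k \<in> borel_measurable M"
  shows "hitting_partition n \<xi> Y \<in> measurable M (count_space {\<pi>. partition_on {1..n} \<pi>})"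
proof (rule measurable_count_space_eq2[THEN iffD2])
  have "{\<pi>. partition_on {1..n} \<pi>} \<subseteq> Pow (Pow {1..n})"
    by (auto simp: partition_on_def)
  then show "finite {\<pi>. partition_on {1..n} \<pi>}"
    by (rule finite_subset) simp
  have "hitting_partition n \<xi> Y -` {\<pi>} \<inter> space M \<in> sets M" if "partition_on {1..n} \<pi>" for \<pi>
  proof -
    have "finite \<pi>"
      using that by (intro finite_elements[of "{1..n}"]) auto
    then obtain bs where bs: "set bs = \<pi>" "distinct bs"
      using finite_distinct_list by blast
    have "Measurable.pred M (\<lambda>\<omega>. hitting_partition n \<xi> Y \<omega> = set bs)"
      using bs that assms by (intro pred_hitting_partition) auto
    moreover have "hitting_partition n \<xi> Y -` {\<pi>} \<inter> space M = {\<omega> \<in> space M. hitting_partition n \<xi> Y \<omega> = set bs}"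
      using bs by auto
    ultimately show ?thesis by (simp add: pred_def)
  qed
  then show "hitting_partition n \<xi> Y \<in> space M \<rightarrow> {\<pi>. partition_on {1..n} \<pi>} \<and>
      (\<forall>\<pi>\<in>{\<pi>. partition_on {1..n} \<pi>}. hitting_partition n \<xi> Y -` {\<pi>} \<inter> space M \<in> sets M)"
    using partition_on_hitting_partition by auto
qed

section \<open>From independent rows to independent columns\<close>

context prob_space
begin

text \<open>A finite set of cells is grouped by rows. Independence of the rows splits the
  probability into row events, and independence inside each row splits those into cells.\<close>

lemma indep_vars_array:
  fixes Y :: "'i \<Rightarrow> 'k \<Rightarrow> 'a \<Rightarrow> 'b"
  assumes rows: "indep_vars (\<lambda>_. PiM K (\<lambda>_. N)) (\<lambda>l \<omega>. \<lambda>k\<in>K. Y l k \<omega>) I"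
    and cells: "\<And>l. l \<in> I \<Longrightarrow> indep_vars (\<lambda>_. N) (Y l) K"
  shows "indep_vars (\<lambda>_. N) (\<lambda>(l, k). Y l k) (I \<times> K)"
  unfolding indep_vars_def2
proof (intro conjI ballI)
  have meas [measurable]: "Y l k \<in> measurable M N" if "l \<in> I" "k \<in> K" for l k
    using cells that unfolding indep_vars_def2 by blast
  show "(case p of (l, k) \<Rightarrow> Y l k) \<in> measurable M N" if "p \<in> I \<times> K" for p
    using that meas by auto
  show "indep_sets (\<lambda>p. {(case p of (l, k) \<Rightarrow> Y l k) -` A \<inter> space M |A. A \<in> sets N}) (I \<times> K)"
  proof (rule indep_setsI)
    fix p assume "p \<in> I \<times> K"
    then show "{(case p of (l, k) \<Rightarrow> Y l k) -` A \<inter> space M |A. A \<in> sets N} \<subseteq> events"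
      using meas by (auto intro!: measurable_sets)
  next
    fix A J assume J: "J \<noteq> {}" "J \<subseteq> I \<times> K" "finite J"
      and "\<forall>p\<in>J. A p \<in> {(case p of (l, k) \<Rightarrow> Y l k) -` A \<inter> space M |A. A \<in> sets N}"
    then have "\<forall>p\<in>J. \<exists>C. C \<in> sets N \<and> A p = (case p of (l, k) \<Rightarrow> Y l k) -` C \<inter> space M"
      by blast
    from bchoice[OF this] obtain B
      where B0: "\<And>p. p \<in> J \<Longrightarrow> B p \<in> sets N \<and> A p = (case p of (l, k) \<Rightarrow> Y l k) -` B p \<inter> space M"
      by blast
    have B: "B (l, k) \<in> sets N" "A (l, k) = Y l k -` B (l, k) \<inter> space M" if "(l, k) \<in> J" for l k
      using B0[OF that] by auto
    define L where "L = fst ` J"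
    define C where "C l = {k. (l, k) \<in> J}" for l
    have L: "finite L" "L \<noteq> {}" "L \<subseteq> I" using J by (auto simp: L_def)
    have C: "finite (C l)" "C l \<subseteq> K" for l
    proof -
      have "C l \<subseteq> snd ` J" by (force simp: C_def)
      then show "finite (C l)" using J(3) by (auto intro: finite_subset)
    qed (use J in \<open>auto simp: C_def\<close>)
    have C_ne: "C l \<noteq> {}" if "l \<in> L" for l using that by (auto simp: L_def C_def)
    have J_eq: "J = Sigma L C" by (force simp: L_def C_def)
    \<comment> \<open>The constraints on the cells of row \<open>l\<close>, as a cylinder in the
      space of rows: the event to which independence of the rows applies.\<close>
    define D where "D l = {r \<in> space (PiM K (\<lambda>_. N)). \<forall>k\<in>C l. r k \<in> B (l, k)}" for l
    have D: "D l \<in> sets (PiM K (\<lambda>_. N))" for l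
      unfolding D_def
    proof (rule sets.sets_Collect_finite_All)
      fix k assume "k \<in> C l"
      then have "k \<in> K" "B (l, k) \<in> sets N" using C(2) B(1) by (auto simp: C_def)
      then have "(\<lambda>r. r k) -` B (l, k) \<inter> space (PiM K (\<lambda>_. N)) \<in> sets (PiM K (\<lambda>_. N))"
        by (intro measurable_sets[OF measurable_component_singleton])
      then show "{r \<in> space (PiM K (\<lambda>_. N)). r k \<in> B (l, k)} \<in> sets (PiM K (\<lambda>_. N))"
        by (simp add: vimage_def Int_def conj_commute)
    qed (rule C(1))
    have row: "(\<lambda>\<omega>. \<lambda>k\<in>K. Y l k \<omega>) -` D l \<inter> space M = (\<Inter>k\<in>C l. Y l k -` B (l, k) \<inter> space M)"
      if "l \<in> L" for l
    proof -
      have "(\<lambda>k\<in>K. Y l k \<omega>) \<in> space (PiM K (\<lambda>_. N))" if "\<omega> \<in> space M" for \<omega>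
        using that L(3) \<open>l \<in> L\<close> measurable_space[OF meas] by (auto simp: space_PiM)
      then show ?thesis
        using C_ne[OF that] C(2)[of l] by (auto simp: D_def subset_eq)
    qed
    have "(\<Inter>p\<in>J. A p) = (\<Inter>l\<in>L. (\<lambda>\<omega>. \<lambda>k\<in>K. Y l k \<omega>) -` D l \<inter> space M)"
    proof -
      have "(\<Inter>p\<in>J. A p) = (\<Inter>l\<in>L. \<Inter>k\<in>C l. A (l, k))"
        by (auto simp: J_eq)
      also have "\<dots> = (\<Inter>l\<in>L. \<Inter>k\<in>C l. Y l k -` B (l, k) \<inter> space M)"
        using B(2) by (intro INF_cong refl) (simp add: C_def)
      also have "\<dots> = (\<Inter>l\<in>L. (\<lambda>\<omega>. \<lambda>k\<in>K. Y l k \<omega>) -` D l \<inter> space M)"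
        using row by (intro INF_cong refl) simp
      finally show ?thesis .
    qed
    also have "prob \<dots> = (\<Prod>l\<in>L. prob ((\<lambda>\<omega>. \<lambda>k\<in>K. Y l k \<omega>) -` D l \<inter> space M))"
      using D L by (intro indep_varsD[OF rows]) auto
    also have "\<dots> = (\<Prod>l\<in>L. \<Prod>k\<in>C l. prob (Y l k -` B (l, k) \<inter> space M))"
    proof (rule prod.cong[OF refl])
      fix l assume l: "l \<in> L"
      then have "prob (\<Inter>k\<in>C l. Y l k -` B (l, k) \<inter> space M) = (\<Prod>k\<in>C l. prob (Y l k -` B (l, k) \<inter> space M))"
        using B(1) C C_ne L by (intro indep_varsD[OF cells]) (auto simp: C_def)
      then show "prob ((\<lambda>\<omega>. \<lambda>k\<in>K. Y l k \<omega>) -` D l \<inter> space M) = (\<Prod>k\<in>C l. prob (Y l k -` B (l, k) \<inter> space M))"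
        using row l by simp
    qed
    also have "\<dots> = (\<Prod>p\<in>J. prob (A p))"
      using B(2) L C by (simp add: J_eq prod.Sigma) (intro prod.cong, auto)
    finally show "prob (\<Inter>p\<in>J. A p) = (\<Prod>p\<in>J. prob (A p))" .
  qed
qed

text \<open>Columns use disjoint sets of cells of an independent array. For fixed points the hit
  index of k depends on column k alone, so the hit indices become independent.\<close>

lemma indep_vars_columns:
  fixes Y :: "'i \<Rightarrow> 'k \<Rightarrow> 'a \<Rightarrow> 'b"
  assumes "indep_vars (\<lambda>_. N) (\<lambda>(l, k). Y l k) (UNIV \<times> K)"
  shows "indep_vars (\<lambda>_. PiM UNIV (\<lambda>_. N)) (\<lambda>k \<omega> l. Y l k \<omega>) K"
proof -
  have "indep_vars (\<lambda>k. PiM (UNIV \<times> {k}) (\<lambda>_. N))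
      (\<lambda>k \<omega>. restrict (\<lambda>p. (case p of (l, k) \<Rightarrow> Y l k) \<omega>) (UNIV \<times> {k})) K"
    using assms by (rule indep_vars_restrict) (auto simp: disjoint_family_on_def)
  then have "indep_vars (\<lambda>_. PiM UNIV (\<lambda>_. N))
      (\<lambda>k \<omega>. (\<lambda>r l. r (l, k)) (restrict (\<lambda>p. (case p of (l, k) \<Rightarrow> Y l k) \<omega>) (UNIV \<times> {k}))) K"
  proof (rule indep_vars_compose2)
    fix k
    show "(\<lambda>r l. r (l, k)) \<in> measurable (PiM (UNIV \<times> {k}) (\<lambda>_. N)) (PiM UNIV (\<lambda>_. N))"
      by (rule measurable_PiM_single') (auto simp: space_PiM PiE_def)
  qed
  then show ?thesis by simp
qed

end

section \<open>The Poisson--Dirichlet law of the hitting partition\<close>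

lemma hitting_partition_cong:
  assumes "\<And>l. \<xi> l \<omega> = \<xi>' l \<omega>'" "\<And>l k. k \<in> {1..n} \<Longrightarrow> Y l k \<omega> = Y' l k \<omega>'"
  shows "hitting_partition n \<xi> Y \<omega> = hitting_partition n \<xi>' Y' \<omega>'"
proof -
  have "hit_index \<xi> Y \<omega> k = hit_index \<xi>' Y' \<omega>' k" if "k \<in> {1..n}" for k
    using assms that by (simp add: hit_index_def)
  then show ?thesis
    unfolding hitting_partition_def by (intro arg_cong2[where f="(//)"]) auto
qed

text \<open>With the points fixed, the hit indices are independent and equal l with probability x_l
  / S. Each assignment of distinct indices to blocks then has a product probability, in which the n
  denominators combine to S^n.\<close>

lemma (in prob_space) emeasure_hitting_partition_fixed_points:
  fixes Y :: "nat \<Rightarrow> nat \<Rightarrow> 'a \<Rightarrow> real" and x :: "nat \<Rightarrow> real"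
  assumes cols: "indep_vars (\<lambda>_. PiM UNIV (\<lambda>_. borel)) (\<lambda>k \<omega> l. Y l k \<omega>) {1..n}"
    and col: "\<And>k. k \<in> {1..n} \<Longrightarrow> indep_vars (\<lambda>_. borel) (\<lambda>l. Y l k) UNIV"
    and Y: "\<And>l k. k \<in> {1..n} \<Longrightarrow> frechet1 M \<sigma> (Y l k)" and \<sigma>: "0 < \<sigma>"
    and x: "\<And>l. 0 < x l" "summable x"
    and bs: "distinct bs" "partition_on {1..n} (set bs)" and n: "1 \<le> n"
  shows "emeasure M {\<omega> \<in> space M. hitting_partition n (\<lambda>l _. x l) Y \<omega> = set bs} =
    (\<integral>\<^sup>+ls. (\<Prod>i<length bs. ennreal (x (ls ! i) ^ card (bs ! i))) \<partial>count_space (inj_lists (length bs))) *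
    ennreal (1 / suminf x ^ n)"
proof -
  have [measurable]: "Y l k \<in> borel_measurable M" if "k \<in> {1..n}" for l k
    using Y[OF that] by (simp add: frechet1_def)
  have S: "0 < suminf x" using x by (intro suminf_pos) auto
  have sub: "bs ! i \<subseteq> {1..n}" if "i < length bs" for i
    using partition_onD1[OF bs(2)] nth_mem[OF that] by blast
  have ne: "bs ! i \<noteq> {}" if "i < length bs" for i
    using partition_onD3[OF bs(2)] nth_mem[OF that] by auto
  \<comment> \<open>The columns in which \<open>l\<close> wins strictly. Strictness makes these sets
    disjoint in \<open>l\<close>, and their probabilities come from the race.\<close>
  define C where "C l = {v :: nat \<Rightarrow> real. \<forall>j. j \<noteq> l \<longrightarrow> x j * v j < x l * v l}" for l
  have C [measurable]: "C l \<in> sets (PiM UNIV (\<lambda>_. borel))" for l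
  proof -
    have "{v \<in> space (PiM UNIV (\<lambda>_. borel)). \<forall>j. j \<noteq> l \<longrightarrow> x j * v j < x l * v l} \<in> sets (PiM UNIV (\<lambda>_. borel))"
      by measurable
    then show ?thesis by (simp add: C_def space_PiM)
  qed
  define Ev where "Ev l k = (\<lambda>\<omega> l. Y l k \<omega>) -` C l \<inter> space M" for l k
  have Ev_meas [measurable]: "Ev l k \<in> events" if "k \<in> {1..n}" for l k
    unfolding Ev_def using that C cols by (intro measurable_sets[OF _ C]) (auto simp: indep_vars_def)
  have prob_Ev: "prob (Ev l k) = x l / suminf x" if "k \<in> {1..n}" for l k
  proof -
    have "Ev l k = {\<omega> \<in> space M. \<forall>j. j \<noteq> l \<longrightarrow> x j * Y j k \<omega> < x l * Y l k \<omega>}"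
      by (auto simp: Ev_def C_def)
    then show ?thesis
      using frechet_race[OF col[OF that] Y[OF that] \<sigma> x] by simp
  qed
  have hit: "hit_index (\<lambda>l _. x l) Y \<omega> k = l" if "\<omega> \<in> Ev l k" for \<omega> l k
    using that by (intro hit_index_eqI) (auto simp: Ev_def C_def)
  \<comment> \<open>The winning probabilities x_l / S add up to 1, so a strict winner exists almost
    surely: attainment and uniqueness of the argmax are derived here.\<close>
  have AE_hit: "AE \<omega> in M. \<forall>k\<in>{1..n}. \<exists>l. \<omega> \<in> Ev l k"
  proof (rule AE_finite_allI)
    fix k assume k: "k \<in> {1..n}"
    have "(\<lambda>l. prob (Ev l k)) sums prob (\<Union>l. Ev l k)"
    proof (rule finite_measure_UNION)
      show "disjoint_family (\<lambda>l. Ev l k)"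
        unfolding disjoint_family_on_def by (auto dest!: hit)
    qed (use k in auto)
    moreover have "(\<lambda>l. prob (Ev l k)) sums (suminf x / suminf x)"
      unfolding prob_Ev[OF k] using x by (intro sums_divide summable_sums)
    ultimately have "prob (\<Union>l. Ev l k) = 1"
      using S sums_unique2 by fastforce
    then have "AE \<omega> in M. \<omega> \<in> (\<Union>l. Ev l k)"
      using k by (subst (asm) prob_eq_1) auto
    then show "AE \<omega> in M. \<exists>l. \<omega> \<in> Ev l k" by simp
  qed simp
  define A where "A ls = {\<omega> \<in> space M. \<forall>i<length bs. \<forall>m\<in>bs ! i. \<omega> \<in> Ev (ls ! i) m}" for ls
  have A_meas: "A ls \<in> events" for ls
  proof -
    have "{\<omega> \<in> space M. \<forall>i\<in>{..<length bs}. \<forall>m\<in>bs ! i. \<omega> \<in> Ev (ls ! i) m} \<in> events"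
    proof (intro sets.sets_Collect_finite_All)
      fix i m assume i: "i \<in> {..<length bs}" and m: "m \<in> bs ! i"
      then have "m \<in> {1..n}" using sub[of i] by blast
      then have "Ev (ls ! i) m \<in> events" by (rule Ev_meas)
      moreover have "{\<omega> \<in> space M. \<omega> \<in> Ev (ls ! i) m} = Ev (ls ! i) m" by (auto simp: Ev_def)
      ultimately show "{\<omega> \<in> space M. \<omega> \<in> Ev (ls ! i) m} \<in> events" by simp
    next
      fix i assume "i \<in> {..<length bs}"
      then show "finite (bs ! i)" using sub by (intro finite_subset[of "bs ! i" "{1..n}"]) auto
    qed simp
    also have "{\<omega> \<in> space M. \<forall>i\<in>{..<length bs}. \<forall>m\<in>bs ! i. \<omega> \<in> Ev (ls ! i) m} = A ls"
      unfolding A_def by (simp only: Ball_def lessThan_iff)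
    finally show ?thesis .
  qed
  have inj_eq: "ls = ls'" if "ls \<in> inj_lists (length bs)" "ls' \<in> inj_lists (length bs)" "\<omega> \<in> A ls" "\<omega> \<in> A ls'" for ls ls' \<omega>
  proof (rule nth_equalityI)
    show "length ls = length ls'" using that by (simp add: inj_lists_def)
    fix i assume "i < length ls"
    then have i: "i < length bs" using that by (simp add: inj_lists_def)
    obtain m where "m \<in> bs ! i" using ne[OF i] by blast
    then have "\<omega> \<in> Ev (ls ! i) m" "\<omega> \<in> Ev (ls' ! i) m" using that i by (auto simp: A_def)
    then show "ls ! i = ls' ! i" by (metis hit)
  qed
  have "emeasure M {\<omega> \<in> space M. hitting_partition n (\<lambda>l _. x l) Y \<omega> = set bs} =
      emeasure M (\<Union>ls\<in>inj_lists (length bs). A ls)"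
  proof (rule emeasure_eq_AE)
    show "AE \<omega> in M. \<omega> \<in> {\<omega> \<in> space M. hitting_partition n (\<lambda>l _. x l) Y \<omega> = set bs} \<longleftrightarrow>
        \<omega> \<in> (\<Union>ls\<in>inj_lists (length bs). A ls)"
      using AE_hit
    proof (rule AE_mp, intro AE_I2 impI)
      fix \<omega> assume \<omega>: "\<omega> \<in> space M" and ex: "\<forall>k\<in>{1..n}. \<exists>l. \<omega> \<in> Ev l k"
      have iff: "hit_index (\<lambda>l _. x l) Y \<omega> m = l \<longleftrightarrow> \<omega> \<in> Ev l m" if "m \<in> {1..n}" for m l
        using ex that hit by blast
      have "(\<forall>i<length bs. \<forall>m\<in>bs ! i. hit_index (\<lambda>l _. x l) Y \<omega> m = ls ! i) \<longleftrightarrow> \<omega> \<in> A ls" for ls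
        using \<omega> sub iff unfolding A_def by blast
      then show "\<omega> \<in> {\<omega> \<in> space M. hitting_partition n (\<lambda>l _. x l) Y \<omega> = set bs} \<longleftrightarrow>
          \<omega> \<in> (\<Union>ls\<in>inj_lists (length bs). A ls)"
        using \<omega> by (simp add: hitting_partition_eq_iff[OF bs])
    qed
    show "{\<omega> \<in> space M. hitting_partition n (\<lambda>l _. x l) Y \<omega> = set bs} \<in> events"
      using pred_hitting_partition[OF bs, of "\<lambda>l _. x l" M Y] by (simp add: pred_def)
    show "(\<Union>ls\<in>inj_lists (length bs). A ls) \<in> events"
      using A_meas by (intro sets.countable_UN') auto
  qed
  also have "\<dots> = (\<integral>\<^sup>+ls. emeasure M (A ls) \<partial>count_space (inj_lists (length bs)))"
    using A_meas inj_eq by (intro emeasure_UN_countable) (auto simp: disjoint_family_on_def)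
  also have "\<dots> = (\<integral>\<^sup>+ls. (\<Prod>i<length bs. ennreal (x (ls ! i) ^ card (bs ! i))) * ennreal (1 / suminf x ^ n)
      \<partial>count_space (inj_lists (length bs)))"
  proof (rule nn_integral_cong)
    fix ls :: "nat list"
    \<comment> \<open>\<open>L m\<close> is the index assigned to the block containing
      \<open>m\<close>; it rewrites the event blockwise as one condition per column.\<close>
    define L where "L m = ls ! (THE i. i < length bs \<and> m \<in> bs ! i)" for m
    have L: "L m = ls ! i" if "i < length bs" "m \<in> bs ! i" for i m
    proof -
      have "(THE i. i < length bs \<and> m \<in> bs ! i) = i"
      proof (rule the_equality)
        fix j assume j: "j < length bs \<and> m \<in> bs ! j"
        then have "bs ! i = bs ! j"
          using that nth_mem[of i bs] nth_mem[of j bs] disjointD[OF partition_onD2[OF bs(2)], of "bs ! i" "bs ! j"]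
          by blast
        then show "j = i" using j that bs(1) by (simp add: nth_eq_iff_index_eq)
      qed (use that in simp)
      then show ?thesis by (simp add: L_def)
    qed
    have ex: "\<exists>i<length bs. m \<in> bs ! i" if "m \<in> {1..n}" for m
      using that unfolding partition_onD1[OF bs(2)] by (auto simp: in_set_conv_nth)
    have "A ls = (\<Inter>m\<in>{1..n}. Ev (L m) m)"
      using n sub ex L by (fastforce simp: A_def Ev_def)
    also have "prob \<dots> = (\<Prod>m\<in>{1..n}. prob (Ev (L m) m))"
      unfolding Ev_def using n C by (intro indep_varsD[OF cols]) auto
    also have "\<dots> = (\<Prod>m\<in>{1..n}. x (L m)) / suminf x ^ n"
      by (simp add: prob_Ev prod_dividef)
    also have "(\<Prod>m\<in>{1..n}. x (L m)) = (\<Prod>i<length bs. \<Prod>m\<in>bs ! i. x (L m))"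
      by (rule prod_blocks[OF bs, symmetric])
    also have "\<dots> = (\<Prod>i<length bs. x (ls ! i) ^ card (bs ! i))"
      by (intro prod.cong refl) (simp add: L)
    finally show "emeasure M (A ls) = (\<Prod>i<length bs. ennreal (x (ls ! i) ^ card (bs ! i))) * ennreal (1 / suminf x ^ n)"
      using x S by (simp add: emeasure_eq_measure prod_ennreal less_imp_le prod_nonneg ennreal_mult'[symmetric] divide_inverse)
  qed
  also have "\<dots> = (\<integral>\<^sup>+ls. (\<Prod>i<length bs. ennreal (x (ls ! i) ^ card (bs ! i))) \<partial>count_space (inj_lists (length bs))) *
      ennreal (1 / suminf x ^ n)"
    by (rule nn_integral_multc) simp
  finally show ?thesis .
qed

lemma exp_neg_split_tuple:
  assumes "distinct ls" "\<And>l. 0 \<le> f (x l)"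
  shows "exp_neg (\<integral>\<^sup>+l. ennreal (f (x l)) \<partial>count_space UNIV) =
    (\<Prod>i<length ls. ennreal (exp (- f (x (ls ! i))))) * rest_exp f x (set ls)"
  using assms(1)
proof (induction ls rule: rev_induct)
  case Nil
  then show ?case by (simp add: rest_exp_def)
next
  case (snoc l ls)
  have "rest_exp f x (set ls) = ennreal (exp (- f (x l))) * rest_exp f x (insert l (set ls))"
    using snoc.prems assms(2) by (intro rest_exp_insert) auto
  moreover have "(\<Prod>i<length ls. ennreal (exp (- f (x ((ls @ [l]) ! i))))) = (\<Prod>i<length ls. ennreal (exp (- f (x (ls ! i)))))"
    by (intro prod.cong) (auto simp: nth_append)
  ultimately show ?case
    using snoc by (simp add: mult_ac)
qed

text \<open>The factor exp(-l y) in each weight restores the tuple points that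
  \<open>rest_exp\<close> leaves out. The exponential of the full sum then no longer depends on the
  tuple and leaves the sum.\<close>

lemma tuple_sum_tilted:
  fixes x :: "nat \<Rightarrow> real" and l :: real
  assumes "\<And>j. 0 \<le> x j" "0 \<le> l"
  shows "tuple_sum k (\<lambda>i y. y ^ m i * exp (- (l * y))) (\<lambda>y. l * y) x =
    (\<integral>\<^sup>+ls. (\<Prod>i<k. ennreal (x (ls ! i) ^ m i)) \<partial>count_space (inj_lists k)) *
    exp_neg (\<integral>\<^sup>+j. ennreal (l * x j) \<partial>count_space UNIV)"
proof -
  have "tuple_sum k (\<lambda>i y. y ^ m i * exp (- (l * y))) (\<lambda>y. l * y) x =
      (\<integral>\<^sup>+ls. (\<Prod>i<k. ennreal (x (ls ! i) ^ m i)) * exp_neg (\<integral>\<^sup>+j. ennreal (l * x j) \<partial>count_space UNIV)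
        \<partial>count_space (inj_lists k))"
    unfolding tuple_sum_def
  proof (rule nn_integral_cong)
    fix ls assume "ls \<in> space (count_space (inj_lists k))"
    then have ls: "distinct ls" "length ls = k" by (auto simp: inj_lists_def)
    show "(\<Prod>i<k. ennreal (x (ls ! i) ^ m i * exp (- (l * x (ls ! i))))) * rest_exp (\<lambda>y. l * y) x (set ls) =
        (\<Prod>i<k. ennreal (x (ls ! i) ^ m i)) * exp_neg (\<integral>\<^sup>+j. ennreal (l * x j) \<partial>count_space UNIV)"
      using exp_neg_split_tuple[OF ls(1), of "\<lambda>y. l * y" x] assms ls(2)
      by (simp add: ennreal_mult prod.distrib mult.assoc)
  qed
  then show ?thesis by (simp add: nn_integral_multc)
qed

lemma rising_one_eq_pochhammer: "rising x m 1 = pochhammer x m"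
  by (simp add: rising_def pochhammer_prod atLeast0LessThan add.commute)

lemma rising_self: "rising \<alpha> m \<alpha> = \<alpha> ^ m * fact m"
  by (induction m) (simp_all add: rising_def algebra_simps)

text \<open>Gamma(m - \<alpha>) = Gamma(1 - \<alpha>) (1 - \<alpha>)_(m-1) cancels the power of
  Gamma(1 - \<alpha>). The remaining \<alpha>^(k-1) (k-1)! is the rising factorial of \<alpha> with
  step \<alpha>, and Gamma(n) is that of 1 with step 1.\<close>

lemma pd_eppf_0_eq:
  fixes m :: "nat \<Rightarrow> nat"
  assumes \<alpha>: "0 < \<alpha>" "\<alpha> < 1" and ns: "\<And>i. i < length ns \<Longrightarrow> 1 \<le> ns ! i" and k: "1 \<le> length ns"
  shows "(\<Prod>i<length ns. \<alpha> * Gamma (real (ns ! i) - \<alpha>)) / Gamma (real (sum_list ns)) *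
      (fact (length ns - 1) / (\<alpha> * Gamma (1 - \<alpha>) ^ length ns)) = pd_eppf \<alpha> 0 ns"
proof -
  let ?k = "length ns"
  have c: "0 < Gamma (1 - \<alpha>)" using \<alpha> by simp
  have G: "Gamma (real (ns ! i) - \<alpha>) = Gamma (1 - \<alpha>) * rising (1 - \<alpha>) (ns ! i - 1) 1" if "i < ?k" for i
  proof -
    have "pochhammer (1 - \<alpha>) (ns ! i - 1) = Gamma (1 - \<alpha> + real (ns ! i - 1)) / Gamma (1 - \<alpha>)"
      using \<alpha> by (intro pochhammer_Gamma) (auto elim!: nonpos_Ints_cases)
    moreover have "1 - \<alpha> + real (ns ! i - 1) = real (ns ! i) - \<alpha>"
      using ns[OF that] by (simp add: of_nat_diff)
    ultimately show ?thesis using c by (simp add: rising_one_eq_pochhammer field_simps)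
  qed
  have pos: "1 \<le> sum_list ns"
    using ns[of 0] k member_le_sum_list[of "ns ! 0" ns] by (cases ns) auto
  let ?P = "\<Prod>m\<leftarrow>ns. rising (1 - \<alpha>) (m - 1) 1"
  have "(\<Prod>i<?k. rising (1 - \<alpha>) (ns ! i - 1) 1) = ?P"
    by (simp add: prod.list_conv_set_nth atLeast0LessThan)
  then have num: "(\<Prod>i<?k. \<alpha> * Gamma (real (ns ! i) - \<alpha>)) = (\<alpha> * Gamma (1 - \<alpha>)) ^ ?k * ?P"
    by (simp add: G prod.distrib mult_ac power_mult_distrib)
  have den: "Gamma (real (sum_list ns)) = rising (0 + 1) (sum_list ns - 1) 1"
    using Gamma_fact[of "sum_list ns - 1", where 'a=real] pos
    by (simp add: rising_one_eq_pochhammer pochhammer_fact of_nat_diff)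
  have pow: "(\<alpha> * Gamma (1 - \<alpha>)) ^ ?k = \<alpha> * \<alpha> ^ (?k - 1) * Gamma (1 - \<alpha>) ^ ?k"
    using k by (cases ?k) (simp_all add: power_mult_distrib)
  show ?thesis
    unfolding num den pow pd_eppf_def add_0 rising_self
    using \<alpha> less_imp_neq[OF c] by simp
qed

text \<open>All Frechet variables share an arbitrary scale \<sigma>; the case \<sigma> = 1 is the
  one in the English statement.\<close>

theorem proposition1p1:
  fixes M :: "'w measure" and \<alpha> \<sigma> :: real and n :: nat
    and \<xi> :: "nat \<Rightarrow> 'w \<Rightarrow> real" and Y :: "nat \<Rightarrow> nat \<Rightarrow> 'w \<Rightarrow> real"
  assumes "prob_space M"
    and "0 < \<alpha>" and "\<alpha> < 1" and "1 \<le> n" and "0 < \<sigma>"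
    and "poisson_enumeration M (stable_intensity \<alpha>) \<xi>"
    and "\<And>l k. k \<in> {1..n} \<Longrightarrow> frechet1 M \<sigma> (Y l k)"
    and "\<And>l. iid_vars M borel (Y l) {1..n}"
    and "iid_vars M (Pi\<^sub>M {1..n} (\<lambda>_. borel)) (\<lambda>l \<omega>. \<lambda>k\<in>{1..n}. Y l k \<omega>) UNIV"
    and "indep_elements M
           (Pi\<^sub>M UNIV (\<lambda>_. borel)) (\<lambda>\<omega> l. \<xi> l \<omega>)
           (Pi\<^sub>M UNIV (\<lambda>_. Pi\<^sub>M {1..n} (\<lambda>_. borel))) (\<lambda>\<omega> l. \<lambda>k\<in>{1..n}. Y l k \<omega>)"
  shows "pd_partition M \<alpha> 0 n (hitting_partition n \<xi> Y)"
proof -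
  note \<alpha> = assms(2,3) and n = assms(4) and \<sigma> = assms(5) and frechet = assms(7)
    and rows = assms(9) and indep = assms(10)
  interpret prob_space M by fact
  interpret poisson_points M "stable_intensity \<alpha>" \<xi>
    by (intro poisson_points.intro poisson_points_axioms.intro sigma_finite_stable_intensity) fact+
  have \<xi>_meas [measurable]: "\<xi> l \<in> borel_measurable M" for l
  proof -
    have "(\<lambda>x. x) \<in> borel_measurable (stable_intensity \<alpha>)"
      by (rule borel_measurable_stable_intensity) simp
    from measurable_compose[OF X_measurable this] show ?thesis by simp
  qed
  have \<xi>_pos: "0 < \<xi> l \<omega>" if "\<omega> \<in> space M" for l \<omega>
    using X_space[OF that] by (simp add: space_stable_intensity)
  have Y_meas [measurable]: "Y l k \<in> borel_measurable M" if "k \<in> {1..n}" for l k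
    using frechet[OF that] by (simp add: frechet1_def)
  have rows_ind: "indep_vars (\<lambda>_. PiM {1..n} (\<lambda>_. borel)) (\<lambda>l \<omega>. \<lambda>k\<in>{1..n}. Y l k \<omega>) UNIV"
    using rows by (simp add: iid_vars_def)
  have cols: "indep_vars (\<lambda>_. PiM UNIV (\<lambda>_. borel)) (\<lambda>k \<omega> l. Y l k \<omega>) {1..n}"
    using assms(8) by (intro indep_vars_columns indep_vars_array rows_ind) (auto simp: iid_vars_def)
  have col: "indep_vars (\<lambda>_. borel) (\<lambda>l. Y l k) UNIV" if "k \<in> {1..n}" for k
  proof -
    have "indep_vars (\<lambda>_. borel) (\<lambda>l \<omega>. (\<lambda>r. r k) (\<lambda>k\<in>{1..n}. Y l k \<omega>)) UNIV"
      using that by (intro indep_vars_compose2[OF rows_ind] measurable_component_singleton)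
    then show ?thesis using that by simp
  qed

  \<comment> \<open>Almost sure finiteness of the total mass\<close>
  define T where "T \<omega> = (\<integral>\<^sup>+l. ennreal (\<xi> l \<omega>) \<partial>count_space UNIV)" for \<omega>
  have T_meas [measurable]: "T \<in> borel_measurable M"
    unfolding T_def by (intro borel_measurable_nn_integral_count_space) auto
  have scale: "(\<integral>\<^sup>+l. ennreal (t * \<xi> l \<omega>) \<partial>count_space UNIV) = ennreal t * T \<omega>" if "0 < t" for t \<omega>
    using that by (simp add: T_def ennreal_mult' nn_integral_cmult)
  let ?c = "Gamma (1 - \<alpha>)"
  have c: "0 < ?c" using \<alpha> by simp
  have laplace: "(\<integral>\<^sup>+\<omega>. exp_neg (ennreal t * T \<omega>) \<partial>M) = ennreal (exp (- (?c * t powr \<alpha>)))" if t: "0 < t" for t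
  proof -
    have "(\<integral>\<^sup>+\<omega>. exp_neg (\<integral>\<^sup>+l. ennreal (t * \<xi> l \<omega>) \<partial>count_space UNIV) \<partial>M) =
        exp_neg (\<integral>\<^sup>+x. 1 - exp_neg (ennreal (t * x)) \<partial>stable_intensity \<alpha>)"
      by (intro laplace_functional borel_measurable_stable_intensity) measurable
    then show ?thesis
      using c by (simp add: scale[OF t] nn_integral_stable_one_minus_exp[OF \<alpha> t] exp_neg_ennreal)
  qed
  \<comment> \<open>e^(-t T) vanishes where T is infinite and is at most 1 elsewhere, so exp(-c
    t^\<alpha>) is a lower bound for P(T < infinity) for each t > 0; now let t tend to 0.\<close>
  have T_fin: "AE \<omega> in M. T \<omega> < \<infinity>"
  proof -
    have lower: "exp (- (?c * t powr \<alpha>)) \<le> prob {\<omega> \<in> space M. T \<omega> < \<infinity>}" if t: "0 < t" for t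
    proof -
      have "exp_neg (ennreal t * T \<omega>) \<le> indicator {\<omega> \<in> space M. T \<omega> < \<infinity>} \<omega>" if "\<omega> \<in> space M" for \<omega>
        using that t exp_neg_le_1 by (cases "T \<omega> = \<infinity>") (auto simp: ennreal_mult_top less_top indicator_def)
      then have "ennreal (exp (- (?c * t powr \<alpha>))) \<le> (\<integral>\<^sup>+\<omega>. indicator {\<omega> \<in> space M. T \<omega> < \<infinity>} \<omega> \<partial>M)"
        unfolding laplace[OF t, symmetric] by (intro nn_integral_mono)
      also have "\<dots> = ennreal (prob {\<omega> \<in> space M. T \<omega> < \<infinity>})"
        by (subst nn_integral_indicator) (auto simp: emeasure_eq_measure)
      finally show ?thesis by simp
    qed
    have "1 \<le> prob {\<omega> \<in> space M. T \<omega> < \<infinity>}"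
    proof (rule LIMSEQ_le_const2)
      have "(\<lambda>N. exp (- (?c * inverse (real (Suc N)) powr \<alpha>))) \<longlonglongrightarrow> exp (- (?c * 0))"
        using tendsto_powr'[OF LIMSEQ_inverse_real_of_nat tendsto_const[of \<alpha>]] \<alpha>
        by (intro tendsto_exp tendsto_minus tendsto_mult tendsto_const) auto
      then show "(\<lambda>N. exp (- (?c * inverse (real (Suc N)) powr \<alpha>))) \<longlonglongrightarrow> 1" by simp
      show "\<exists>N. \<forall>m\<ge>N. exp (- (?c * inverse (real (Suc m)) powr \<alpha>)) \<le> prob {\<omega> \<in> space M. T \<omega> < \<infinity>}"
        using lower by auto
    qed
    then have "prob {\<omega> \<in> space M. T \<omega> < \<infinity>} = 1"
      by (intro antisym) auto
    then show ?thesis by (subst (asm) prob_Collect_eq_1) auto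
  qed
  \<comment> \<open>The real sum is meaningful only where the series converges; there it agrees with
    the extended sum \<open>T\<close>, which is almost everywhere.\<close>
  define S where "S \<omega> = (\<Sum>l. \<xi> l \<omega>)" for \<omega>
  have [measurable]: "S \<in> borel_measurable M"
    unfolding S_def by measurable
  have S: "AE \<omega> in M. summable (\<lambda>l. \<xi> l \<omega>) \<and> T \<omega> = ennreal (S \<omega>) \<and> 0 < S \<omega>"
    using T_fin
  proof (rule AE_mp, intro AE_I2 impI)
    fix \<omega> assume \<omega>: "\<omega> \<in> space M" and fin: "T \<omega> < \<infinity>"
    have T_eq: "T \<omega> = (\<Sum>l. ennreal (\<xi> l \<omega>))" by (simp add: T_def nn_integral_count_space_nat)
    have nonneg: "\<And>l. 0 \<le> \<xi> l \<omega>" using \<xi>_pos[OF \<omega>] by (simp add: less_imp_le)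
    then have "summable (\<lambda>l. \<xi> l \<omega>)"
      using fin by (intro summable_suminf_not_top) (auto simp: T_eq)
    then show "summable (\<lambda>l. \<xi> l \<omega>) \<and> T \<omega> = ennreal (S \<omega>) \<and> 0 < S \<omega>"
      using nonneg \<xi>_pos[OF \<omega>] by (auto simp: T_eq S_def suminf_ennreal2 intro: suminf_pos)
  qed

  \<comment> \<open>The probability of a given partition\<close>
  show ?thesis
    unfolding pd_partition_def
  proof (intro conjI allI impI)
    show "hitting_partition n \<xi> Y \<in> measurable M (count_space {\<pi>. partition_on {1..n} \<pi>})"
      by (rule measurable_hitting_partition) measurable
    fix bs assume "distinct bs \<and> partition_on {1..n} (set bs)"
    then have bs: "distinct bs" "partition_on {1..n} (set bs)" by auto
    define k where "k = length bs"
    define m where "m i = card (bs ! i)" for i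
    have k: "1 \<le> k"
      using partition_onD1[OF bs(2)] n by (cases bs) (auto simp: k_def)
    have fin_block: "finite B" if "B \<in> set bs" for B
      using finite_subset[OF Union_upper[OF that]] unfolding partition_onD1[OF bs(2), symmetric] by simp
    have m: "1 \<le> m i" if "i < k" for i
    proof -
      have "bs ! i \<in> set bs" using that by (simp add: k_def)
      then have "bs ! i \<noteq> {}" "finite (bs ! i)"
        using partition_onD3[OF bs(2)] fin_block by auto
      then show ?thesis by (simp add: m_def Suc_le_eq card_gt_0_iff)
    qed
    have sum_m: "sum_list (map card bs) = n" "(\<Sum>i<k. m i) = n"
    proof -
      have "n = card (\<Union>(set bs))"
        using partition_onD1[OF bs(2)] by (metis card_atLeastAtMost diff_Suc_1)
      also have "\<dots> = sum card (set bs)"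
        using partition_onD2[OF bs(2)] fin_block
        by (intro card_Union_disjoint) (auto simp: disjoint_def pairwise_def disjnt_def)
      also have "\<dots> = sum_list (map card bs)"
        using bs(1) by (simp add: sum_list_distinct_conv_sum_set)
      finally show "sum_list (map card bs) = n" by simp
      then show "(\<Sum>i<k. m i) = n"
        by (simp add: sum_list_sum_nth k_def m_def atLeast0LessThan)
    qed
    define Q where "Q \<omega> = (\<integral>\<^sup>+ls. (\<Prod>i<k. ennreal (\<xi> (ls ! i) \<omega> ^ m i)) \<partial>count_space (inj_lists k))" for \<omega>
    have [measurable]: "Q \<in> borel_measurable M"
      unfolding Q_def by (intro borel_measurable_nn_integral_count_space) auto

    have "emeasure M {\<omega> \<in> space M. hitting_partition n \<xi> Y \<omega> = set bs} =
        (\<integral>\<^sup>+\<omega>. emeasure M {\<omega>' \<in> space M. hitting_partition n (\<lambda>l _. \<xi> l \<omega>) Y \<omega>' = set bs} \<partial>M)"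
    proof -
      let ?N = "Pi\<^sub>M UNIV (\<lambda>_. borel) :: (nat \<Rightarrow> real) measure"
      let ?N' = "Pi\<^sub>M UNIV (\<lambda>_. Pi\<^sub>M {1..n} (\<lambda>_. borel)) :: (nat \<Rightarrow> nat \<Rightarrow> real) measure"
      \<comment> \<open>The partition as a function on the canonical product space of points and
        rows. One event \<open>E\<close> then describes both the actual partition and the one with
        points frozen.\<close>
      let ?P = "\<lambda>p. hitting_partition n (\<lambda>l p. fst p l) (\<lambda>l k p. snd p l k) (p :: (nat \<Rightarrow> real) \<times> (nat \<Rightarrow> nat \<Rightarrow> real))"
      define E where "E = {p \<in> space (?N \<Otimes>\<^sub>M ?N'). ?P p = set bs}"
      have "Measurable.pred (?N \<Otimes>\<^sub>M ?N') (\<lambda>p. ?P p = set bs)"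
      proof (rule pred_hitting_partition[OF bs])
        show "(\<lambda>p. fst p l) \<in> borel_measurable (?N \<Otimes>\<^sub>M ?N')" for l
          by measurable
        fix l k assume k: "k \<in> {1..n}"
        have "(\<lambda>p. snd p l) \<in> measurable (?N \<Otimes>\<^sub>M ?N') (Pi\<^sub>M {1..n} (\<lambda>_. borel))"
          by measurable
        from measurable_compose[OF this measurable_component_singleton[OF k]]
        show "(\<lambda>p. snd p l k) \<in> borel_measurable (?N \<Otimes>\<^sub>M ?N')" .
      qed
      then have E: "E \<in> sets (?N \<Otimes>\<^sub>M ?N')"
        by (simp add: E_def pred_def)
      have in_E: "((\<lambda>l. \<xi> l \<omega>), (\<lambda>l. \<lambda>k\<in>{1..n}. Y l k \<omega>')) \<in> E \<longleftrightarrow>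
          hitting_partition n (\<lambda>l _. \<xi> l \<omega>) Y \<omega>' = set bs" for \<omega> \<omega>'
      proof -
        have "?P ((\<lambda>l. \<xi> l \<omega>), (\<lambda>l. \<lambda>k\<in>{1..n}. Y l k \<omega>')) = hitting_partition n (\<lambda>l _. \<xi> l \<omega>) Y \<omega>'"
          by (rule hitting_partition_cong) auto
        then show ?thesis by (auto simp: E_def space_pair_measure space_PiM)
      qed
      have "hitting_partition n (\<lambda>l _. \<xi> l \<omega>) Y \<omega> = hitting_partition n \<xi> Y \<omega>" for \<omega>
        by (rule hitting_partition_cong) auto
      then show ?thesis
        using emeasure_indep_elements[OF indep E] unfolding in_E by simp
    qed
    also have "\<dots> = (\<integral>\<^sup>+\<omega>. Q \<omega> * ennreal (1 / S \<omega> ^ n) \<partial>M)"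
    proof (rule nn_integral_cong_AE, rule AE_mp[OF S], intro AE_I2 impI)
      fix \<omega> assume \<omega>: "\<omega> \<in> space M" and "summable (\<lambda>l. \<xi> l \<omega>) \<and> T \<omega> = ennreal (S \<omega>) \<and> 0 < S \<omega>"
      then show "emeasure M {\<omega>' \<in> space M. hitting_partition n (\<lambda>l _. \<xi> l \<omega>) Y \<omega>' = set bs} =
          Q \<omega> * ennreal (1 / S \<omega> ^ n)"
        using \<xi>_pos[OF \<omega>] unfolding Q_def S_def k_def m_def
        by (intro emeasure_hitting_partition_fixed_points[OF cols col frechet \<sigma> _ _ bs n]) auto
    qed
    \<comment> \<open>The Gamma integral trades the nonlinear 1 / S^n for exponentials of S, which
      the Mecke formula can absorb.\<close>
    also have "\<dots> = (\<integral>\<^sup>+\<omega>. (\<integral>\<^sup>+t. Q \<omega> * ennreal (t powr (real n - 1) / Gamma n * exp (- (S \<omega> * t))) * indicator {0<..} t \<partial>lborel) \<partial>M)"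
    proof (rule nn_integral_cong_AE, use S in eventually_elim)
      case (elim \<omega>)
      have G: "0 < Gamma (real n)" using n by simp
      have "(\<integral>\<^sup>+t. ennreal (t powr (real n - 1) / Gamma n * exp (- (S \<omega> * t))) * indicator {0<..} t \<partial>lborel) =
          (\<integral>\<^sup>+t. ennreal (1 / Gamma n) * (ennreal (t powr (real n - 1) * exp (- (S \<omega> * t))) * indicator {0<..} t) \<partial>lborel)"
        using G by (intro nn_integral_cong) (simp add: mult.assoc[symmetric] ennreal_mult'[symmetric])
      also have "\<dots> = ennreal (1 / Gamma n) * ennreal (Gamma n * S \<omega> powr (- real n))"
        using nn_integral_Gamma_kernel[of "real n" "S \<omega>"] n elim by (subst nn_integral_cmult) auto
      also have "\<dots> = ennreal (1 / S \<omega> ^ n)"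
        using G elim by (simp add: ennreal_mult'[symmetric] powr_minus powr_realpow divide_inverse)
      finally show ?case
        by (simp add: nn_integral_cmult mult.assoc)
    qed
    also have "\<dots> = (\<integral>\<^sup>+t. (\<integral>\<^sup>+\<omega>. Q \<omega> * ennreal (t powr (real n - 1) / Gamma n * exp (- (S \<omega> * t))) * indicator {0<..} t \<partial>M) \<partial>lborel)"
    proof -
      interpret pair_sigma_finite M lborel
        by (intro pair_sigma_finite.intro sigma_finite_measure_axioms lborel.sigma_finite_measure_axioms
            prob_space_imp_sigma_finite prob_space_axioms)
      show ?thesis by (rule Fubini'[symmetric]) measurable
    qed
    \<comment> \<open>The exponents add up to (n - 1) + (k \<alpha> - n) = k \<alpha> - 1: the block
      sizes survive only in the constant.\<close>
    also have "\<dots> = (\<integral>\<^sup>+t. ennreal ((\<Prod>i<k. \<alpha> * Gamma (real (m i) - \<alpha>)) / Gamma n) *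
        (ennreal (t powr (real k * \<alpha> - 1) * exp (- (?c * t powr \<alpha>))) * indicator {0<..} t) \<partial>lborel)"
    proof (rule nn_integral_cong)
      fix t :: real
      show "(\<integral>\<^sup>+\<omega>. Q \<omega> * ennreal (t powr (real n - 1) / Gamma n * exp (- (S \<omega> * t))) * indicator {0<..} t \<partial>M) =
          ennreal ((\<Prod>i<k. \<alpha> * Gamma (real (m i) - \<alpha>)) / Gamma n) *
            (ennreal (t powr (real k * \<alpha> - 1) * exp (- (?c * t powr \<alpha>))) * indicator {0<..} t)"
      proof (cases "0 < t")
        case t: True
        let ?g = "\<lambda>i y. y ^ m i * exp (- (t * y))"
        have G: "0 < Gamma (real n)" using n by simp
        have g_int: "(\<integral>\<^sup>+y. ennreal (?g i y) \<partial>stable_intensity \<alpha>) =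
            ennreal (\<alpha> * Gamma (m i - \<alpha>) * t powr (\<alpha> - m i))" if "i < k" for i
          using nn_integral_stable_power[OF \<alpha> t m[OF that]] .
        have "(\<integral>\<^sup>+\<omega>. Q \<omega> * ennreal (exp (- (S \<omega> * t))) \<partial>M) =
            (\<integral>\<^sup>+\<omega>. tuple_sum k ?g (\<lambda>y. t * y) (\<lambda>l. \<xi> l \<omega>) \<partial>M)"
        proof (rule nn_integral_cong_AE, rule AE_mp[OF S], intro AE_I2 impI)
          fix \<omega> assume \<omega>: "\<omega> \<in> space M" and S\<omega>: "summable (\<lambda>l. \<xi> l \<omega>) \<and> T \<omega> = ennreal (S \<omega>) \<and> 0 < S \<omega>"
          have "tuple_sum k ?g (\<lambda>y. t * y) (\<lambda>l. \<xi> l \<omega>) = Q \<omega> * exp_neg (ennreal t * T \<omega>)"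
            unfolding Q_def scale[OF t, symmetric]
            using \<xi>_pos[OF \<omega>] t by (intro tuple_sum_tilted) (auto intro: less_imp_le)
          then show "Q \<omega> * ennreal (exp (- (S \<omega> * t))) = tuple_sum k ?g (\<lambda>y. t * y) (\<lambda>l. \<xi> l \<omega>)"
            using S\<omega> t by (simp add: ennreal_mult'[symmetric] exp_neg_ennreal mult.commute)
        qed
        also have "\<dots> = (\<Prod>i<k. \<integral>\<^sup>+y. ennreal (?g i y) \<partial>stable_intensity \<alpha>) *
            exp_neg (\<integral>\<^sup>+y. 1 - exp_neg (ennreal (t * y)) \<partial>stable_intensity \<alpha>)"
          using t by (intro multivariate_mecke)
            (auto simp: space_stable_intensity g_int intro!: borel_measurable_stable_intensity)
        also have "\<dots> = (\<Prod>i<k. ennreal (\<alpha> * Gamma (m i - \<alpha>) * t powr (\<alpha> - m i))) * ennreal (exp (- (?c * t powr \<alpha>)))"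
          using c by (simp add: g_int nn_integral_stable_one_minus_exp[OF \<alpha> t] exp_neg_ennreal)
        also have "(\<Prod>i<k. ennreal (\<alpha> * Gamma (m i - \<alpha>) * t powr (\<alpha> - m i))) =
            ennreal (\<Prod>i<k. \<alpha> * Gamma (m i - \<alpha>) * t powr (\<alpha> - m i))"
          using m \<alpha> by (intro prod_ennreal) (auto intro!: mult_nonneg_nonneg Gamma_real_nonneg simp: less_le_trans)
        also have "(\<Prod>i<k. \<alpha> * Gamma (m i - \<alpha>) * t powr (\<alpha> - m i)) =
            (\<Prod>i<k. \<alpha> * Gamma (m i - \<alpha>)) * t powr (real k * \<alpha> - real n)"
        proof -
          have "(\<Sum>i<k. \<alpha> - real (m i)) = real k * \<alpha> - real n"
            using sum_m(2) by (simp add: sum_subtractf flip: of_nat_sum)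
          then have "t powr (real k * \<alpha> - real n) = (\<Prod>i<k. t powr (\<alpha> - m i))"
            using powr_sum[of t "\<lambda>i. \<alpha> - real (m i)" "{..<k}"] t by simp
          then show ?thesis
            by (simp only: prod.distrib)
        qed
        finally have E: "(\<integral>\<^sup>+\<omega>. Q \<omega> * ennreal (exp (- (S \<omega> * t))) \<partial>M) =
            ennreal ((\<Prod>i<k. \<alpha> * Gamma (m i - \<alpha>)) * t powr (real k * \<alpha> - real n)) * ennreal (exp (- (?c * t powr \<alpha>)))" .
        have w: "ennreal (t powr (real n - 1) / Gamma n * exp r) = ennreal (t powr (real n - 1) / Gamma n) * ennreal (exp r)" for r
          using G by (intro ennreal_mult) auto
        have "(\<integral>\<^sup>+\<omega>. Q \<omega> * ennreal (t powr (real n - 1) / Gamma n * exp (- (S \<omega> * t))) * indicator {0<..} t \<partial>M) =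
            (\<integral>\<^sup>+\<omega>. ennreal (t powr (real n - 1) / Gamma n) * (Q \<omega> * ennreal (exp (- (S \<omega> * t)))) \<partial>M)"
          using t unfolding w by (intro nn_integral_cong) (simp add: mult_ac)
        also have "\<dots> = ennreal (t powr (real n - 1) / Gamma n) *
            (ennreal ((\<Prod>i<k. \<alpha> * Gamma (m i - \<alpha>)) * t powr (real k * \<alpha> - real n)) * ennreal (exp (- (?c * t powr \<alpha>))))"
          by (subst nn_integral_cmult) (auto simp: E)
        also have "\<dots> = ennreal ((t powr (real n - 1) / Gamma n) *
            ((\<Prod>i<k. \<alpha> * Gamma (m i - \<alpha>)) * t powr (real k * \<alpha> - real n) * exp (- (?c * t powr \<alpha>))))"
          using G by (simp add: ennreal_mult'[symmetric] ennreal_mult''[symmetric])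
        also have "(t powr (real n - 1) / Gamma n) *
            ((\<Prod>i<k. \<alpha> * Gamma (m i - \<alpha>)) * t powr (real k * \<alpha> - real n) * exp (- (?c * t powr \<alpha>))) =
            ((\<Prod>i<k. \<alpha> * Gamma (m i - \<alpha>)) / Gamma n) * (t powr (real k * \<alpha> - 1) * exp (- (?c * t powr \<alpha>)))"
        proof -
          have "t powr (real k * \<alpha> - 1) = t powr (real n - 1) * t powr (real k * \<alpha> - real n)"
            by (simp add: powr_add[symmetric])
          then show ?thesis by simp
        qed
        also have "ennreal ((\<Prod>i<k. \<alpha> * Gamma (m i - \<alpha>)) / Gamma n * (t powr (real k * \<alpha> - 1) * exp (- (?c * t powr \<alpha>)))) =
            ennreal ((\<Prod>i<k. \<alpha> * Gamma (m i - \<alpha>)) / Gamma n) * ennreal (t powr (real k * \<alpha> - 1) * exp (- (?c * t powr \<alpha>)))"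
          by (rule ennreal_mult'') simp
        finally show ?thesis
          using t by simp
      qed simp
    qed
    also have "\<dots> = ennreal ((\<Prod>i<k. \<alpha> * Gamma (real (m i) - \<alpha>)) / Gamma n) *
        ennreal (fact (k - 1) / (\<alpha> * ?c ^ k))"
      using nn_integral_powr_exp_powr[OF \<alpha>(1) c k] by (subst nn_integral_cmult) auto
    also have "\<dots> = ennreal ((\<Prod>i<k. \<alpha> * Gamma (real (m i) - \<alpha>)) / Gamma n * (fact (k - 1) / (\<alpha> * ?c ^ k)))"
      using \<alpha> c by (intro ennreal_mult''[symmetric]) simp
    also have "(\<Prod>i<k. \<alpha> * Gamma (real (m i) - \<alpha>)) / Gamma n * (fact (k - 1) / (\<alpha> * ?c ^ k)) =
        pd_eppf \<alpha> 0 (map card bs)"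
      using pd_eppf_0_eq[OF \<alpha>, of "map card bs"] m k sum_m(1) by (simp add: k_def m_def)
    finally have "emeasure M {\<omega> \<in> space M. hitting_partition n \<xi> Y \<omega> = set bs} = ennreal (pd_eppf \<alpha> 0 (map card bs))" .
    \<comment> \<open>\<open>ennreal\<close> truncates negative numbers, so only nonnegativity lets
      the equation determine the real probability.\<close>
    moreover have "0 \<le> pd_eppf \<alpha> 0 (map card bs)"
      using \<alpha> by (auto simp: pd_eppf_def rising_def intro!: divide_nonneg_nonneg mult_nonneg_nonneg prod_nonneg prod_list_nonneg)
    ultimately show "prob {\<omega> \<in> space M. hitting_partition n \<xi> Y \<omega> = set bs} = pd_eppf \<alpha> 0 (map card bs)"
      by (simp add: emeasure_eq_measure)
  qed
qed

end
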